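(* Let $T$ be a string of length $n$ over an alphabet $\Sigma$, and let $T'$ be any string with edit distance $\mathrm{ed}(T,T')=1$ (so $T'$ is obtained from $T$ by a single character insertion, deletion, or substitution; $|T'|\in\{n+1,n-1,n\}$ accordingly). Then $$\mathsf{size}(T') \le 8\,\mathsf{size}(T)+4 .$$ Consequently, for the worst-case multiplicative sensitivities $\mathrm{MS}_{\mathrm{ins}}(\mathsf{size},n)$, $\mathrm{MS}_{\mathrm{del}}(\mathsf{size},n)$, $\mathrm{MS}_{\mathrm{sub}}(\mathsf{size},n)$, every ratio $\mathsf{size}(T')/\mathsf{size}(T)$ over which these maxima are taken is at most $(8\,\mathsf{size}(T)+4)/\mathsf{size}(T)$.
   Context: Strings are over a finite alphabet $\Sigma$. For a string $T$, $\mathrm{Substr}(T)$, $\mathrm{Prefix}(T)$, $\mathrm{Suffix}(T)$ denote its sets of substrings, prefixes and suffixes (each including the empty string $\varepsilon$). A string $w\in\mathrm{Substr}(T)$ is left-maximal in $T$ if $w\in\mathrm{Prefix}(T)$ or there exist distinct characters $a,b\in\Sigma$ with $aw,bw\in\mathrm{Substr}(T)$; it is right-maximal in $T$ if $w\in\mathrm{Suffix}(T)$ or there exist distinct $a,b\in\Sigma$ with $wa,wb\in\mathrm{Substr}(T)$. Let $\mathsf{LeftM}(T)$, $\mathsf{RightM}(T)$ be the sets of left-maximal and right-maximal substrings of $T$ and $\mathsf{M}(T)=\mathsf{LeftM}(T)\cap\mathsf{RightM}(T)$. For a string $x$, let $\mathsf{D}_T(x)=|\{a\in\Sigma : xa\in\mathrm{Substr}(T)\}|$.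 The size of the compact directed acyclic word graph (CDAWG) of $T$ is $\mathsf{size}(T)=\sum_{x\in\mathsf{M}(T)}\mathsf{D}_T(x)$ (its number of edges). With $\mathcal{K}(T,1)=\{S:\mathrm{ed}(S,T)=1\}$, the sensitivities are $\mathrm{MS}_{\mathrm{ins}}(\mathsf{size},n)=\max_{T\in\Sigma^n,\,T'\in\mathcal{K}(T,1)\cap\Sigma^{n+1}}\mathsf{size}(T')/\mathsf{size}(T)$, and analogously $\mathrm{MS}_{\mathrm{del}}$ with $\Sigma^{n-1}$ and $\mathrm{MS}_{\mathrm{sub}}$ with $\Sigma^{n}$. *)

theory Defs
  imports Complex_Main
begin

definition Substr :: "'a list \<Rightarrow> 'a list set" where
  "Substr T = {w. \<exists>u v. T = u @ w @ v}"

definition Prefix :: "'a list \<Rightarrow> 'a list set" where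
  "Prefix T = {w. \<exists>v. T = w @ v}"

definition Suffix :: "'a list \<Rightarrow> 'a list set" where
  "Suffix T = {w. \<exists>u. T = u @ w}"

definition LeftM :: "'a list \<Rightarrow> 'a list set" where
  "LeftM T = {w \<in> Substr T. w \<in> Prefix T \<or>
      (\<exists>a b. a \<noteq> b \<and> a # w \<in> Substr T \<and> b # w \<in> Substr T)}"

definition RightM :: "'a list \<Rightarrow> 'a list set" where
  "RightM T = {w \<in> Substr T. w \<in> Suffix T \<or>
      (\<exists>a b. a \<noteq> b \<and> w @ [a] \<in> Substr T \<and> w @ [b] \<in> Substr T)}"

definition MaxRep :: "'a list \<Rightarrow> 'a list set" where
  "MaxRep T = LeftM T \<inter> RightM T"

definition Dout :: "'a list \<Rightarrow> 'a list \<Rightarrow> nat" where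
  "Dout T x = card {a. x @ [a] \<in> Substr T}"

text \<open>Number of edges of the CDAWG of T.\<close>
definition cdawg_size :: "'a list \<Rightarrow> nat" where
  "cdawg_size T = (\<Sum>x\<in>MaxRep T. Dout T x)"

fun ed :: "'a list \<Rightarrow> 'a list \<Rightarrow> nat" where
  "ed [] ys = length ys"
| "ed xs [] = length xs"
| "ed (x # xs) (y # ys) =
     min (ed xs ys + (if x = y then 0 else 1))
         (min (ed xs (y # ys) + 1) (ed (x # xs) ys + 1))"

end

theory Submission
  imports Defs "HOL-Library.Multiset"
begin

text \<open>
  Write \<open>T = P @ s @ R\<close> and \<open>T' = P @ t @ R\<close> with \<open>length t \<le> 1\<close>, and let \<open>e\<close> and \<open>m \<le> e + 1\<close> be the
  numbers of edges and nodes of the CDAWG of \<open>T\<close>. Everything new in \<open>T'\<close> happens at the occurrences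
  that touch the edit. Touching occurrences of \<open>x\<close> overlap so much that \<open>x\<close> is periodic: all but the
  first have the same left neighbour, all but the last the same right neighbour.

  The edges \<open>(x, a)\<close> of \<open>T'\<close> with \<open>xa\<close> in \<open>T\<close> and \<open>x\<close> right-maximal in \<open>T\<close> number at most \<open>2e\<close>: if \<open>x\<close>
  is left-maximal in \<open>T\<close> they are edges of \<open>T\<close>; otherwise \<open>x\<close> is determined by the prefix \<open>q\<close> of \<open>R\<close> in
  which it ends at an occurrence with a new left neighbour, and the edges are charged to the
  closure of \<open>q\<close>, the node of \<open>T\<close> in which all occurrences of \<open>q\<close> are contained. A new right neighbour
  of \<open>x\<close> at an occurrence starting in \<open>P\<close> is determined by the suffix \<open>p\<close> of \<open>P\<close> that starts there.
  If \<open>p\<close> is left-maximal in \<open>T\<close>, it is charged to the closure of \<open>p\<close>; this accounts for all remaining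
  edges of most \<open>x\<close>, at a cost of \<open>2m\<close>. Each exceptional \<open>x\<close> costs at most two further edges and has
  different neighbours, on both sides, at its first and its last touching occurrence. Among the
  exceptional \<open>x\<close> with the same last touching occurrence, the longest is charged to the suffix of \<open>P\<close>
  starting at the last touching occurrence, and the others to the one starting at the first. Hence there are at
  most \<open>2m - 1\<close> exceptional strings, and the total is at most \<open>2e + 6m - 2 \<le> 8e + 4\<close>.
\<close>

section \<open>Occurrences and maximality\<close>

text \<open>The neighbouring letters of an occurrence, with \<open>None\<close> for the boundary of the string, make
  ``prefix or two distinct left letters'' a statement about a single set of symbols.\<close>

definition occ :: "'a list \<Rightarrow> 'a list \<Rightarrow> nat \<Rightarrow> bool" where
  "occ U x i \<longleftrightarrow> i + length x \<le> length U \<and> (\<forall>k<length x. U ! (i + k) = x ! k)"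

definition lsym :: "'a list \<Rightarrow> nat \<Rightarrow> 'a option" where
  "lsym U i = (if i = 0 then None else Some (U ! (i - 1)))"

definition rsym :: "'a list \<Rightarrow> nat \<Rightarrow> 'a option" where
  "rsym U j = (if j \<ge> length U then None else Some (U ! j))"

definition left_ext :: "'a list \<Rightarrow> 'a list \<Rightarrow> 'a option \<Rightarrow> bool" where
  "left_ext U x \<sigma> \<longleftrightarrow> (\<exists>i. occ U x i \<and> lsym U i = \<sigma>)"

definition right_ext :: "'a list \<Rightarrow> 'a list \<Rightarrow> 'a option \<Rightarrow> bool" where
  "right_ext U x \<sigma> \<longleftrightarrow> (\<exists>i. occ U x i \<and> rsym U (i + length x) = \<sigma>)"

lemma occ_iff_append: "occ U x i \<longleftrightarrow> (\<exists>u v. U = u @ x @ v \<and> length u = i)"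
proof
  assume o: "occ U x i"
  have "take (length x) (drop i U) = x"
    using o by (intro nth_equalityI) (auto simp: occ_def)
  then have "U = take i U @ x @ drop (length x) (drop i U)"
    by (metis append_take_drop_id)
  moreover have "length (take i U) = i" using o by (auto simp: occ_def)
  ultimately show "\<exists>u v. U = u @ x @ v \<and> length u = i" by blast
next
  assume "\<exists>u v. U = u @ x @ v \<and> length u = i"
  then show "occ U x i" by (auto simp: occ_def nth_append)
qed

lemma occ_le: "occ U x i \<Longrightarrow> i + length x \<le> length U"
  by (simp add: occ_def)

lemma occ_nth: "occ U x i \<Longrightarrow> k < length x \<Longrightarrow> U ! (i + k) = x ! k"
  by (simp add: occ_def)

lemma occ_unique: "occ U x i \<Longrightarrow> occ U y i \<Longrightarrow> length x = length y \<Longrightarrow> x = y"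
  by (intro nth_equalityI) (auto simp: occ_def)

lemma occ_prefix: "occ U (x @ y) i \<Longrightarrow> occ U x i"
  unfolding occ_iff_append by fastforce

lemma occ_suffix: "occ U (x @ y) i \<Longrightarrow> occ U y (i + length x)"
  unfolding occ_iff_append by (metis append.assoc length_append)

lemma occ_snoc: "occ U (x @ [a]) i \<longleftrightarrow> occ U x i \<and> rsym U (i + length x) = Some a"
  by (auto simp: occ_def rsym_def nth_append less_Suc_eq)

lemma occ_Cons: "occ U (a # x) i \<longleftrightarrow> occ U x (Suc i) \<and> lsym U (Suc i) = Some a"
  by (auto simp: occ_def lsym_def nth_Cons less_Suc_eq_0_disj)

lemma Substr_iff_occ: "x \<in> Substr U \<longleftrightarrow> (\<exists>i. occ U x i)"
  by (auto simp: Substr_def occ_iff_append)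

lemma Prefix_iff_left_ext: "x \<in> Prefix U \<longleftrightarrow> left_ext U x None"
  by (auto simp: Prefix_def left_ext_def lsym_def occ_iff_append)

lemma Suffix_iff_right_ext: "x \<in> Suffix U \<longleftrightarrow> right_ext U x None"
proof
  assume "x \<in> Suffix U"
  then obtain u where "U = u @ x" by (auto simp: Suffix_def)
  then show "right_ext U x None"
    unfolding right_ext_def by (intro exI[of _ "length u"]) (auto simp: occ_def rsym_def nth_append)
qed (auto simp: Suffix_def right_ext_def rsym_def occ_iff_append split: if_splits)

lemma Cons_Substr_iff: "a # x \<in> Substr U \<longleftrightarrow> left_ext U x (Some a)"
proof
  assume "a # x \<in> Substr U"
  then show "left_ext U x (Some a)" by (auto simp: Substr_iff_occ occ_Cons left_ext_def)
next
  assume "left_ext U x (Some a)"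
  then obtain i where "occ U x i" "lsym U i = Some a" by (auto simp: left_ext_def)
  then show "a # x \<in> Substr U"
    by (cases i) (auto simp: Substr_iff_occ occ_Cons lsym_def)
qed

lemma snoc_Substr_iff: "x @ [a] \<in> Substr U \<longleftrightarrow> right_ext U x (Some a)"
  by (auto simp: Substr_iff_occ occ_snoc right_ext_def)

lemma left_ext_Substr: "left_ext U x \<sigma> \<Longrightarrow> x \<in> Substr U"
  by (auto simp: Substr_iff_occ left_ext_def)

lemma right_ext_Substr: "right_ext U x \<sigma> \<Longrightarrow> x \<in> Substr U"
  by (auto simp: Substr_iff_occ right_ext_def)

lemma LeftM_iff: "x \<in> LeftM U \<longleftrightarrow>
    left_ext U x None \<or> (\<exists>\<sigma> \<tau>. \<sigma> \<noteq> \<tau> \<and> left_ext U x \<sigma> \<and> left_ext U x \<tau>)"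
proof -
  have "(\<exists>\<sigma> \<tau>. \<sigma> \<noteq> \<tau> \<and> left_ext U x \<sigma> \<and> left_ext U x \<tau>) \<longleftrightarrow>
      (\<exists>a b. a \<noteq> b \<and> left_ext U x (Some a) \<and> left_ext U x (Some b))"
    if "\<not> left_ext U x None"
    using that by (simp add: split_option_ex)
  moreover have "x \<in> Substr U" if "left_ext U x \<sigma>" for \<sigma>
    using that by (rule left_ext_Substr)
  ultimately show ?thesis
    unfolding LeftM_def Prefix_iff_left_ext Cons_Substr_iff mem_Collect_eq by blast
qed

lemma RightM_iff: "x \<in> RightM U \<longleftrightarrow>
    right_ext U x None \<or> (\<exists>\<sigma> \<tau>. \<sigma> \<noteq> \<tau> \<and> right_ext U x \<sigma> \<and> right_ext U x \<tau>)"
proof -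
  have "(\<exists>\<sigma> \<tau>. \<sigma> \<noteq> \<tau> \<and> right_ext U x \<sigma> \<and> right_ext U x \<tau>) \<longleftrightarrow>
      (\<exists>a b. a \<noteq> b \<and> right_ext U x (Some a) \<and> right_ext U x (Some b))"
    if "\<not> right_ext U x None"
    using that by (simp add: split_option_ex)
  moreover have "x \<in> Substr U" if "right_ext U x \<sigma>" for \<sigma>
    using that by (rule right_ext_Substr)
  ultimately show ?thesis
    unfolding RightM_def Suffix_iff_right_ext snoc_Substr_iff mem_Collect_eq by blast
qed

lemma not_LeftM_unique:
  assumes "x \<in> Substr U" "x \<notin> LeftM U"
  obtains c where "\<And>\<sigma>. left_ext U x \<sigma> \<longleftrightarrow> \<sigma> = Some c"
proof -
  obtain i where "occ U x i" using assms by (auto simp: Substr_iff_occ)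
  then have "left_ext U x (lsym U i)" by (auto simp: left_ext_def)
  moreover from this obtain c where "lsym U i = Some c"
    using assms(2) unfolding LeftM_iff by (metis option.exhaust)
  ultimately have "left_ext U x \<sigma> \<longleftrightarrow> \<sigma> = Some c" for \<sigma>
    using assms(2) unfolding LeftM_iff by auto
  with that show thesis by blast
qed

lemma not_RightM_unique:
  assumes "x \<in> Substr U" "x \<notin> RightM U"
  obtains c where "\<And>\<sigma>. right_ext U x \<sigma> \<longleftrightarrow> \<sigma> = Some c"
proof -
  obtain i where "occ U x i" using assms by (auto simp: Substr_iff_occ)
  then have "right_ext U x (rsym U (i + length x))" by (auto simp: right_ext_def)
  moreover from this obtain c where "rsym U (i + length x) = Some c"
    using assms(2) unfolding RightM_iff by (metis option.exhaust)
  ultimately have "right_ext U x \<sigma> \<longleftrightarrow> \<sigma> = Some c" for \<sigma>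
    using assms(2) unfolding RightM_iff by auto
  with that show thesis by blast
qed

lemma left_ext_prefix: "left_ext U (x @ y) \<sigma> \<Longrightarrow> left_ext U x \<sigma>"
  unfolding left_ext_def by (metis occ_prefix)

lemma LeftM_prefix: "x @ y \<in> LeftM U \<Longrightarrow> x \<in> LeftM U"
  using left_ext_prefix[of U x y] unfolding LeftM_iff by blast

lemma right_ext_suffix: "right_ext U (x @ y) \<sigma> \<Longrightarrow> right_ext U y \<sigma>"
  unfolding right_ext_def by (metis add.assoc length_append occ_suffix)

lemma RightM_suffix: "x @ y \<in> RightM U \<Longrightarrow> y \<in> RightM U"
  using right_ext_suffix[of U x y] unfolding RightM_iff by blast

section \<open>Closures\<close>

text \<open>One fixed pair of contexts must fit every occurrence of \<open>p\<close>.\<close>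

definition is_closure :: "'a list \<Rightarrow> 'a list \<Rightarrow> 'a list \<Rightarrow> 'a list \<Rightarrow> bool" where
  "is_closure U p a b \<longleftrightarrow>
    (\<forall>i. occ U p i \<longrightarrow> length a \<le> i \<and> occ U (a @ p @ b) (i - length a))"

definition closure :: "'a list \<Rightarrow> 'a list \<Rightarrow> 'a list" where
  "closure U p = (SOME K. K \<in> MaxRep U \<and> (\<exists>a b. K = a @ p @ b \<and> is_closure U p a b))"

text \<open>Contexts of greatest total length work: if the enlarged string were not maximal on one
  side, its unique neighbouring letter there could be added to the context.\<close>

lemma ex_closure:
  assumes "p \<in> Substr U"
  shows "\<exists>K. K \<in> MaxRep U \<and> (\<exists>a b. K = a @ p @ b \<and> is_closure U p a b)"
proof -
  obtain i0 where i0: "occ U p i0"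
    using assms by (auto simp: Substr_iff_occ)
  define A where "A = (\<lambda>(a, b). is_closure U p a b)"
  define len where "len = (\<lambda>(a :: 'a list, b :: 'a list). length a + length b)"
  have "A ([], [])" by (simp add: A_def is_closure_def)
  moreover have "\<forall>z. A z \<longrightarrow> len z < Suc (length U)"
    using i0 by (fastforce simp: A_def len_def is_closure_def dest: occ_le)
  ultimately obtain z where z: "A z" and mx: "\<And>z'. A z' \<Longrightarrow> len z' \<le> len z"
    using ex_has_greatest_nat[of A "([], [])" len "Suc (length U)"] by auto
  obtain a b where ab: "z = (a, b)" by (cases z)
  let ?K = "a @ p @ b"
  have cl: "length a \<le> i" "occ U ?K (i - length a)" if "occ U p i" for i
    using z that by (auto simp: A_def ab is_closure_def)
  have sub: "?K \<in> Substr U" using cl(2)[OF i0] by (auto simp: Substr_iff_occ)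
  have "?K \<in> RightM U"
  proof (rule ccontr)
    assume "?K \<notin> RightM U"
    then obtain c where c: "\<And>\<sigma>. right_ext U ?K \<sigma> \<longleftrightarrow> \<sigma> = Some c"
      using not_RightM_unique[OF sub] by blast
    have "occ U (?K @ [c]) (i - length a)" if "occ U p i" for i
      using c cl(2)[OF that] unfolding occ_snoc right_ext_def by blast
    then have "A (a, b @ [c])" using cl by (auto simp: A_def is_closure_def)
    then show False using mx by (fastforce simp: len_def ab)
  qed
  moreover have "?K \<in> LeftM U"
  proof (rule ccontr)
    assume "?K \<notin> LeftM U"
    then obtain c where c: "\<And>\<sigma>. left_ext U ?K \<sigma> \<longleftrightarrow> \<sigma> = Some c"
      using not_LeftM_unique[OF sub] by blast
    have "length (c # a) \<le> i \<and> occ U ((c # a) @ p @ b) (i - length (c # a))" if "occ U p i" for i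
    proof -
      have l: "lsym U (i - length a) = Some c"
        using c cl(2)[OF that] unfolding left_ext_def by blast
      then obtain j where j: "i - length a = Suc j"
        by (cases "i - length a") (auto simp: lsym_def)
      then have "occ U (c # ?K) j" using l cl(2)[OF that] by (simp add: occ_Cons)
      moreover have "j = i - length (c # a)" using j by simp
      ultimately show ?thesis using j by simp
    qed
    then have "A (c # a, b)" unfolding A_def is_closure_def by blast
    then show False using mx by (fastforce simp: len_def ab)
  qed
  ultimately show ?thesis using z by (auto simp: MaxRep_def A_def ab)
qed

lemma closure_spec:
  assumes "p \<in> Substr U"
  shows "closure U p \<in> MaxRep U \<and> (\<exists>a b. closure U p = a @ p @ b \<and>
    (\<forall>i. occ U p i \<longrightarrow> length a \<le> i \<and> occ U (closure U p) (i - length a)))"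
proof -
  have "closure U p \<in> MaxRep U \<and> (\<exists>a b. closure U p = a @ p @ b \<and> is_closure U p a b)"
    unfolding closure_def by (rule someI_ex[OF ex_closure[OF assms]])
  then show ?thesis by (metis is_closure_def)
qed

lemma closure_MaxRep: "p \<in> Substr U \<Longrightarrow> closure U p \<in> MaxRep U"
  using closure_spec by blast

text \<open>\<open>U\<close> occurs in itself only once, so all occurrences of \<open>p\<close>
  would start at the same place.\<close>

lemma closure_neq_self:
  assumes "occ U p i" "occ U p j" "i \<noteq> j"
  shows "closure U p \<noteq> U"
proof
  assume K: "closure U p = U"
  have "p \<in> Substr U" using assms by (auto simp: Substr_iff_occ)
  then obtain n where le: "\<And>i. occ U p i \<Longrightarrow> n \<le> i"
    and cl: "\<And>i. occ U p i \<Longrightarrow> occ U (closure U p) (i - n)"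
    using closure_spec by blast
  have "i = n" if "occ U p i" for i
    using le[OF that] occ_le[OF cl[OF that]] K by simp
  with assms show False by blast
qed

lemma no_descent:
  assumes "occ U p i" "\<And>j. occ U p j \<Longrightarrow> \<exists>k<j. occ U p k"
  shows False
  using assms(1) by (induction i rule: less_induct) (use assms(2) in blast)

lemma no_ascent:
  assumes "occ U p i" "\<And>j. occ U p j \<Longrightarrow> \<exists>k>j. occ U p k"
  shows False
  using assms(1)
proof (induction "length U - i" arbitrary: i rule: less_induct)
  case less
  from assms(2)[OF less.prems] obtain k where k: "k > i" "occ U p k" by blast
  with occ_le[OF k(2)] have "length U - k < length U - i" by simp
  with less k show False by blast
qed

text \<open>The offset of \<open>p\<close> in the closure is that of \<open>p'\<close> plus \<open>length g\<close>:
  otherwise iterating the shift between the two copies inside the closure would produce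
  occurrences of \<open>p\<close> arbitrarily far to the left or to the right.\<close>
lemma same_closure_suffix:
  assumes pp: "p' = g @ p" and sub: "p' \<in> Substr U" and eq: "closure U p = closure U p'"
    and o: "occ U p j"
  shows "length g \<le> j \<and> occ U p' (j - length g)"
proof -
  have sub': "p \<in> Substr U" using o by (auto simp: Substr_iff_occ)
  obtain n where le: "\<And>i. occ U p i \<Longrightarrow> n \<le> i"
    and cl: "\<And>i. occ U p i \<Longrightarrow> occ U (closure U p) (i - n)"
    using closure_spec[OF sub'] by blast
  obtain a' b' where K': "closure U p' = a' @ p' @ b'"
    using closure_spec[OF sub] by blast
  \<comment> \<open>The common closure lies around each occurrence of \<open>p\<close> and contains
    a copy of \<open>p'\<close>, whose tail is again an occurrence of \<open>p\<close>.\<close>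
  have p': "occ U p' (i - n + length a')" if "occ U p i" for i
    using occ_prefix[OF occ_suffix[OF cl[OF that, unfolded eq K']]] .
  have p: "occ U p (i - n + length a' + length g)" if "occ U p i" for i
    using occ_suffix[of U g p] p'[OF that] pp by simp
  have "\<not> n < length a' + length g"
  proof
    assume l: "n < length a' + length g"
    have "\<exists>k>i. occ U p k" if "occ U p i" for i
      using p[OF that] le[OF that] l by (intro exI[of _ "i - n + length a' + length g"]) auto
    then show False using no_ascent[OF o] by blast
  qed
  moreover have "\<not> n > length a' + length g"
  proof
    assume l: "n > length a' + length g"
    have "\<exists>k<i. occ U p k" if "occ U p i" for i
      using p[OF that] le[OF that] l by (intro exI[of _ "i - n + length a' + length g"]) auto
    then show False using no_descent[OF o] by blast
  qed
  ultimately have "n = length a' + length g" by simp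
  with p'[OF o] le[OF o] show ?thesis by auto
qed

section \<open>Transporting occurrences between copies of a word\<close>

lemma occ_shift:
  assumes "occ V x i" "occ V y j" "j \<le> i" "i + length x \<le> j + length y" "occ U y k"
  shows "occ U x (k + (i - j))"
  unfolding occ_def
proof (intro conjI allI impI)
  show "k + (i - j) + length x \<le> length U" using assms occ_le[OF assms(5)] by simp
  fix n assume n: "n < length x"
  have "U ! (k + (i - j) + n) = y ! (i - j + n)"
    using occ_nth[OF assms(5), of "i - j + n"] n assms by (simp add: add.assoc)
  also have "\<dots> = V ! (i + n)"
    using occ_nth[OF assms(2), of "i - j + n"] n assms by (simp add: add.assoc[symmetric])
  also have "\<dots> = x ! n" using occ_nth[OF assms(1) n] .
  finally show "U ! (k + (i - j) + n) = x ! n" .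
qed

lemma occ_shift_lsym:
  assumes "occ V x i" "occ V y j" "j < i" "i + length x \<le> j + length y" "occ U y k"
  shows "lsym U (k + (i - j)) = lsym V i"
proof -
  have "U ! (k + (i - j - 1)) = y ! (i - j - 1)"
    using occ_nth[OF assms(5), of "i - j - 1"] assms by simp
  also have "\<dots> = V ! (i - 1)"
    using occ_nth[OF assms(2), of "i - j - 1"] assms by simp
  finally show ?thesis using assms(3) by (simp add: lsym_def)
qed

lemma occ_shift_rsym:
  assumes "occ V x i" "occ V y j" "j \<le> i" "i + length x < j + length y" "occ U y k"
  shows "rsym U (k + (i - j) + length x) = rsym V (i + length x)"
proof -
  have "U ! (k + (i - j + length x)) = y ! (i - j + length x)"
    using occ_nth[OF assms(5), of "i - j + length x"] assms by simp
  also have "\<dots> = V ! (i + length x)"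
    using occ_nth[OF assms(2), of "i - j + length x"] assms by simp
  finally show ?thesis using assms occ_le[OF assms(2)] occ_le[OF assms(5)]
    by (simp add: rsym_def add.assoc)
qed

text \<open>Used with \<open>V\<close> the edited and \<open>U\<close> the original string: an
  occurrence with a new neighbour cannot lie, neighbour included, inside a word of \<open>U\<close>.
  Several injectivity arguments rest on this and its mirror image.\<close>

lemma inner_left_ext:
  assumes "occ V x i" "occ V y j" "j < i" "i + length x \<le> j + length y" "y \<in> Substr U"
  shows "left_ext U x (lsym V i)"
proof -
  obtain k where "occ U y k" using assms(5) by (auto simp: Substr_iff_occ)
  with occ_shift[OF assms(1,2)] occ_shift_lsym[OF assms(1-4)] assms(3,4) show ?thesis
    unfolding left_ext_def by (intro exI[of _ "k + (i - j)"]) auto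
qed

lemma inner_right_ext:
  assumes "occ V x i" "occ V y j" "j \<le> i" "i + length x < j + length y" "y \<in> Substr U"
  shows "right_ext U x (rsym V (i + length x))"
proof -
  obtain k where "occ U y k" using assms(5) by (auto simp: Substr_iff_occ)
  with occ_shift[OF assms(1,2)] occ_shift_rsym[OF assms(1-4)] assms(3,4) show ?thesis
    unfolding right_ext_def by (intro exI[of _ "k + (i - j)"]) auto
qed

section \<open>Number of nodes and out-degrees\<close>

lemma finite_Substr: "finite (Substr U)"
proof (rule finite_subset)
  show "Substr U \<subseteq> {x. set x \<subseteq> set U \<and> length x \<le> length U}" by (auto simp: Substr_def)
qed (simp add: finite_lists_length_le)

lemma finite_MaxRep: "finite (MaxRep U)"
  by (rule finite_subset[OF _ finite_Substr]) (auto simp: MaxRep_def LeftM_def)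

lemma finite_out: "finite {a. x @ [a] \<in> Substr U}"
  by (rule finite_subset[of _ "set U"]) (auto simp: Substr_def)

lemma Dout_suffix: "Dout U (z @ q) \<le> Dout U q"
proof -
  have "{a. (z @ q) @ [a] \<in> Substr U} \<subseteq> {a. q @ [a] \<in> Substr U}"
    unfolding snoc_Substr_iff using right_ext_suffix by blast
  then show ?thesis unfolding Dout_def by (rule card_mono[OF finite_out])
qed

text \<open>The first letter of a right context would be the only right symbol of \<open>q\<close>,
  so right-maximality leaves room for a left context only.\<close>

lemma closure_RightM:
  assumes "q \<in> RightM U"
  obtains a where "closure U q = a @ q"
    "\<And>i. occ U q i \<Longrightarrow> length a \<le> i \<and> occ U (closure U q) (i - length a)"
proof -
  have "q \<in> Substr U" using assms by (simp add: RightM_def)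
  then obtain a b where K: "closure U q = a @ q @ b"
    and cl: "\<And>i. occ U q i \<Longrightarrow> length a \<le> i \<and> occ U (closure U q) (i - length a)"
    using closure_spec by blast
  have "b = []"
  proof (cases b)
    case (Cons h b')
    have "rsym U (i + length q) = Some h" if "occ U q i" for i
    proof -
      have "length a \<le> i" "occ U (a @ q @ b) (i - length a)" using cl[OF that] K by auto
      then have "occ U (q @ b) i" using occ_suffix[of U a "q @ b" "i - length a"] by simp
      then have "occ U (q @ [h]) i" using occ_prefix[of U "q @ [h]" b'] Cons by simp
      then show ?thesis by (simp add: occ_snoc)
    qed
    then have "\<sigma> = Some h" if "right_ext U q \<sigma>" for \<sigma>
      using that by (auto simp: right_ext_def)
    then show ?thesis using assms unfolding RightM_iff by blast
  qed
  with K cl that show thesis by simp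
qed

lemma Dout_closure:
  assumes "q \<in> RightM U"
  shows "Dout U q \<le> Dout U (closure U q)"
proof -
  obtain a where K: "closure U q = a @ q"
    and cl: "\<And>i. occ U q i \<Longrightarrow> length a \<le> i \<and> occ U (closure U q) (i - length a)"
    using closure_RightM[OF assms] by blast
  have "right_ext U (closure U q) \<sigma>" if r: "right_ext U q \<sigma>" for \<sigma>
  proof -
    obtain i where i: "occ U q i" "rsym U (i + length q) = \<sigma>" using r by (auto simp: right_ext_def)
    with cl[OF i(1)] K show ?thesis
      unfolding right_ext_def by (intro exI[of _ "i - length a"]) simp
  qed
  then have "{a. q @ [a] \<in> Substr U} \<subseteq> {a. closure U q @ [a] \<in> Substr U}"
    unfolding snoc_Substr_iff by blast
  then show ?thesis unfolding Dout_def by (rule card_mono[OF finite_out])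
qed

text \<open>If all occurrences of \<open>x\<close> ended at the end of \<open>U\<close>, there would
  be just one; left-maximality would then make \<open>x\<close> a prefix, hence \<open>U\<close>
  itself.\<close>

lemma Dout_pos_of_not_self:
  assumes "x \<in> MaxRep U" "x \<noteq> U"
  shows "Dout U x \<ge> 1"
proof -
  have "\<exists>i. occ U x i \<and> i + length x < length U"
  proof (rule ccontr)
    assume n: "\<not> ?thesis"
    then have one: "i + length x = length U" if "occ U x i" for i
      using that occ_le by force
    then have "i = j" if "occ U x i" "occ U x j" for i j
      using that by (metis add_right_cancel)
    then have "\<sigma> = \<tau>" if "left_ext U x \<sigma>" "left_ext U x \<tau>" for \<sigma> \<tau>
      using that unfolding left_ext_def by blast
    then have "left_ext U x None"
      using assms(1) unfolding MaxRep_def Int_iff LeftM_iff by blast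
    then have "occ U x 0" by (auto simp: left_ext_def lsym_def split: if_splits)
    with one have "length x = length U" by fastforce
    moreover have "occ U U 0" by (simp add: occ_def)
    ultimately show False using occ_unique[OF \<open>occ U x 0\<close>] assms(2) by blast
  qed
  then obtain i where "occ U x i" "i + length x < length U" by blast
  then have "x @ [U ! (i + length x)] \<in> Substr U"
    unfolding snoc_Substr_iff right_ext_def rsym_def by (intro exI[of _ i]) auto
  then have "{a. x @ [a] \<in> Substr U} \<noteq> {}" by blast
  then show ?thesis using finite_out[of x U] unfolding Dout_def
    by (simp add: Suc_le_eq card_gt_0_iff)
qed

lemma self_MaxRep: "U \<in> MaxRep U"
proof -
  have "occ U U 0" by (simp add: occ_def)
  then have "left_ext U U None" "right_ext U U None"
    by (force simp: left_ext_def right_ext_def lsym_def rsym_def)+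
  then show ?thesis by (simp add: MaxRep_def LeftM_iff RightM_iff)
qed

lemma card_MaxRep_le: "card (MaxRep U) \<le> cdawg_size U + 1"
proof -
  have "card (MaxRep U) = card (MaxRep U - {U}) + 1"
    using card.remove[OF finite_MaxRep self_MaxRep, of U] by simp
  also have "card (MaxRep U - {U}) = (\<Sum>x\<in>MaxRep U - {U}. 1)" by simp
  also have "\<dots> \<le> (\<Sum>x\<in>MaxRep U - {U}. Dout U x)"
    by (intro sum_mono Dout_pos_of_not_self) auto
  also have "\<dots> \<le> cdawg_size U"
    unfolding cdawg_size_def by (intro sum_mono2 finite_MaxRep) auto
  finally show ?thesis by simp
qed

lemma Dout_le_1: "x \<notin> RightM U \<Longrightarrow> Dout U x \<le> 1"
proof -
  assume "x \<notin> RightM U"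
  then have "a = b" if "x @ [a] \<in> Substr U" "x @ [b] \<in> Substr U" for a b
    using that unfolding RightM_iff snoc_Substr_iff by blast
  then show ?thesis
    unfolding Dout_def using card_le_Suc0_iff_eq[OF finite_out[of x U]] by simp
qed

section \<open>Overlapping occurrences\<close>

text \<open>A word of length \<open>a + b - 1\<close> with periods \<open>a\<close> and \<open>b\<close>: deleting the letter at \<open>a - 1\<close> or the
  letter at \<open>b - 1\<close> leaves the same multiset of letters.\<close>
lemma two_periods:
  fixes g :: "nat \<Rightarrow> 'a"
  assumes "0 < a" "0 < b"
    and pa: "\<And>k. k < b - 1 \<Longrightarrow> g (k + a) = g k"
    and pb: "\<And>k. k < a - 1 \<Longrightarrow> g (k + b) = g k"
  shows "g (a - 1) = g (b - 1)"
proof -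
  have *: "mset (map g [0..<a + b - 1])
      = mset (map g [0..<a - 1]) + {#g (a - 1)#} + mset (map g [0..<b - 1])"
    if "0 < a" "0 < b" "\<And>k. k < b - 1 \<Longrightarrow> g (k + a) = g k" for a b
  proof -
    have "[0..<a + b - 1] = [0..<a - 1] @ [a - 1] @ [a..<a + (b - 1)]"
      using that upt_add_eq_append[of 0 a "b - 1"] upt_Suc_append[of 0 "a - 1"] by simp
    moreover have "map g [a..<a + (b - 1)] = map (\<lambda>k. g (k + a)) [0..<b - 1]"
      by (intro nth_equalityI) (simp_all add: add.commute)
    moreover have "map (\<lambda>k. g (k + a)) [0..<b - 1] = map g [0..<b - 1]" using that(3) by simp
    ultimately show ?thesis by (simp only: map_append mset_append) simp
  qed
  have "mset (map g [0..<a - 1]) + {#g (a - 1)#} + mset (map g [0..<b - 1])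
      = mset (map g [0..<b - 1]) + {#g (b - 1)#} + mset (map g [0..<a - 1])"
    using *[OF assms(1-3)] *[OF assms(2,1) pb] by (simp add: add.commute)
  then show ?thesis by simp
qed

lemma occ_period:
  assumes "occ U x i" "occ U x j" "i < j" "k + (j - i) < length x"
  shows "x ! (k + (j - i)) = x ! k"
  using occ_nth[OF assms(1), of "k + (j - i)"] occ_nth[OF assms(2), of k] assms
  by (simp add: add.commute add.left_commute)

text \<open>Both gaps are periods of \<open>x\<close>, and the letter after each of the first two
  occurrences lies in the next one. The distance bound gives \<open>x\<close> the
  \<open>?a + ?b - 1\<close> letters that \<open>two_periods\<close> needs; \<open>x\<close> is read
  backwards.\<close>

lemma three_occ_same_right:
  assumes "occ U x i" "occ U x j" "occ U x k" "i < j" "j < k" "k \<le> i + length x + 1"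
  shows "rsym U (i + length x) = rsym U (j + length x)"
proof -
  let ?L = "length x" and ?a = "j - i" and ?b = "k - j"
  have "x ! (?L - 1 - (?a - 1)) = x ! (?L - 1 - (?b - 1))"
  proof (rule two_periods[of ?a ?b "\<lambda>n. x ! (?L - 1 - n)"])
    fix n assume "n < ?b - 1"
    then show "x ! (?L - 1 - (n + ?a)) = x ! (?L - 1 - n)"
      using occ_period[OF assms(1,2), of "?L - 1 - (n + ?a)"] assms by simp
  next
    fix n assume "n < ?a - 1"
    then show "x ! (?L - 1 - (n + ?b)) = x ! (?L - 1 - n)"
      using occ_period[OF assms(2,3), of "?L - 1 - (n + ?b)"] assms by simp
  qed (use assms in auto)
  moreover have "?L - 1 - (?a - 1) = ?L - ?a" "?L - 1 - (?b - 1) = ?L - ?b"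
    using assms by auto
  ultimately have "x ! (?L - ?a) = x ! (?L - ?b)" by simp
  moreover have "U ! (i + ?L) = x ! (?L - ?a)"
    using occ_nth[OF assms(2), of "?L - ?a"] assms by (simp add: add.commute)
  moreover have "U ! (j + ?L) = x ! (?L - ?b)"
    using occ_nth[OF assms(3), of "?L - ?b"] assms by (simp add: add.commute)
  ultimately show ?thesis using occ_le[OF assms(3)] assms by (simp add: rsym_def)
qed

lemma three_occ_same_left:
  assumes "occ U x i" "occ U x j" "occ U x k" "i < j" "j < k" "k \<le> i + length x + 1"
  shows "lsym U j = lsym U k"
proof -
  let ?a = "j - i" and ?b = "k - j"
  have "x ! (?a - 1) = x ! (?b - 1)"
  proof (rule two_periods[of ?a ?b "\<lambda>n. x ! n"])
    fix n assume "n < ?b - 1"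
    then show "x ! (n + ?a) = x ! n"
      using occ_period[OF assms(1,2), of n] assms by simp
  next
    fix n assume "n < ?a - 1"
    then show "x ! (n + ?b) = x ! n"
      using occ_period[OF assms(2,3), of n] assms by simp
  qed (use assms in auto)
  moreover have "U ! (j - 1) = x ! (?a - 1)"
    using occ_nth[OF assms(1), of "?a - 1"] assms by simp
  moreover have "U ! (k - 1) = x ! (?b - 1)"
    using occ_nth[OF assms(2), of "?b - 1"] assms by simp
  ultimately show ?thesis using assms by (simp add: lsym_def)
qed

section \<open>Edit distance one as replacement of a middle factor\<close>

lemma ed_0_eq: "ed xs ys = 0 \<Longrightarrow> xs = ys"
proof (induction xs ys rule: ed.induct)
  case (3 x xs y ys)
  then have "ed xs ys + (if x = y then 0 else 1) = 0" by (simp add: min_def split: if_splits)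
  with 3(1) show ?case by (simp split: if_splits)
qed auto

lemma ed_1_single_edit:
  "ed xs ys = 1 \<Longrightarrow> \<exists>P s t R. xs = P @ s @ R \<and> ys = P @ t @ R \<and> length t \<le> 1"
proof (induction xs ys rule: ed.induct)
  case (1 ys)
  then show ?case by (intro exI[of _ "[]"] exI[of _ ys]) auto
next
  case (2 x xs)
  then show ?case by (intro exI[of _ "[]"] exI[of _ "x # xs"]) auto
next
  case (3 x xs y ys)
  consider "x = y" "ed xs ys = 1" | "ed xs ys = 0" | "ed xs (y # ys) = 0" | "ed (x # xs) ys = 0"
    using 3(4) by (auto simp: min_def split: if_splits)
  then show ?case
  proof cases
    case 1
    with 3(1) obtain P s t R where "xs = P @ s @ R" "ys = P @ t @ R" "length t \<le> 1" by blast
    with 1 show ?thesis by (intro exI[of _ "x # P"] exI[of _ s] exI[of _ t] exI[of _ R]) auto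
  next
    case 2
    then show ?thesis using ed_0_eq[of xs ys]
      by (intro exI[of _ "[]"] exI[of _ "[x]"] exI[of _ "[y]"] exI[of _ xs]) auto
  next
    case 3
    then show ?thesis using ed_0_eq[of xs "y # ys"]
      by (intro exI[of _ "[]"] exI[of _ "[x]"] exI[of _ "[]"] exI[of _ xs]) auto
  next
    case 4
    then show ?thesis using ed_0_eq[of "x # xs" ys]
      by (intro exI[of _ "[]"] exI[of _ "[]"] exI[of _ "[y]"] exI[of _ ys]) auto
  qed
qed

section \<open>Strings around a single edit\<close>

locale single_edit =
  fixes P s t R :: "'a list"
  assumes t_le: "length t \<le> 1"
begin

abbreviation "T \<equiv> P @ s @ R"
abbreviation "T' \<equiv> P @ t @ R"

text \<open>Occurrences that merely abut the edit count as well: their neighbour on that side may be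
  new.\<close>

definition touch :: "'a list \<Rightarrow> nat set" where
  "touch x = {i. occ T' x i \<and> length P \<le> i + length x \<and> i \<le> length P + length t}"

definition fst_touch :: "'a list \<Rightarrow> nat" where
  "fst_touch x = Min (touch x)"

definition lst_touch :: "'a list \<Rightarrow> nat" where
  "lst_touch x = Max (touch x)"

definition new_left :: "'a list \<Rightarrow> nat \<Rightarrow> bool" where
  "new_left x i \<longleftrightarrow> \<not> left_ext T x (lsym T' i)"

definition new_right :: "'a list \<Rightarrow> nat \<Rightarrow> bool" where
  "new_right x i \<longleftrightarrow> \<not> right_ext T x (rsym T' (i + length x))"

definition good :: "'a list \<Rightarrow> nat set" where
  "good x = {i \<in> touch x. new_right x i \<and> i \<le> length P \<and> drop i P \<in> LeftM T}"

definition new_letters :: "'a list \<Rightarrow> 'a set" where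
  "new_letters x = {a. x @ [a] \<in> Substr T' \<and> x @ [a] \<notin> Substr T}"

text \<open>Two edges per position in \<open>good x\<close> then pay for the new edges of \<open>x\<close>, and for its single old edge if
  \<open>x\<close> is not right-maximal in \<open>T\<close>.\<close>
definition covered :: "'a list \<Rightarrow> bool" where
  "covered x \<longleftrightarrow> (\<forall>i\<in>touch x. new_right x i \<longrightarrow>
    (\<exists>j\<in>good x. rsym T' (j + length x) = rsym T' (i + length x)))"

section \<open>Touching occurrences and new neighbours\<close>

lemma finite_touch: "finite (touch x)"
  by (rule finite_subset[of _ "{..length P + length t}"]) (auto simp: touch_def)

lemma finite_good: "finite (good x)"
  using finite_touch[of x] by (simp add: good_def)

lemma touch_occ: "i \<in> touch x \<Longrightarrow> occ T' x i"
  by (simp add: touch_def)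

lemma fst_touch_in: "i \<in> touch x \<Longrightarrow> fst_touch x \<in> touch x"
  unfolding fst_touch_def using finite_touch by (metis Min_in empty_iff)

lemma lst_touch_in: "i \<in> touch x \<Longrightarrow> lst_touch x \<in> touch x"
  unfolding lst_touch_def using finite_touch by (metis Max_in empty_iff)

lemma fst_touch_le: "i \<in> touch x \<Longrightarrow> fst_touch x \<le> i"
  unfolding fst_touch_def using finite_touch by simp

lemma lst_touch_ge: "i \<in> touch x \<Longrightarrow> i \<le> lst_touch x"
  unfolding lst_touch_def using finite_touch by simp

text \<open>As \<open>length t \<le> 1\<close>, touching occurrences start at most
  \<open>length x + 1\<close> apart, so \<open>three_occ_same_right\<close> applies to the first,
  any inner one and the last. Hence they show at most two right symbols.\<close>

lemma touch_rsym:
  assumes "i \<in> touch x" "i \<noteq> lst_touch x"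
  shows "rsym T' (i + length x) = rsym T' (fst_touch x + length x)"
proof (cases "i = fst_touch x")
  case False
  have f: "fst_touch x < i" "i < lst_touch x"
    using assms False fst_touch_le[OF assms(1)] lst_touch_ge[OF assms(1)] by auto
  moreover have "lst_touch x \<le> fst_touch x + length x + 1"
    using lst_touch_in[OF assms(1)] fst_touch_in[OF assms(1)] t_le by (simp add: touch_def)
  ultimately show ?thesis
    using three_occ_same_right[of T' x "fst_touch x" i "lst_touch x"] touch_occ
      assms(1) lst_touch_in[OF assms(1)] fst_touch_in[OF assms(1)] by simp
qed simp

lemma touch_lsym:
  assumes "i \<in> touch x" "i \<noteq> fst_touch x"
  shows "lsym T' i = lsym T' (lst_touch x)"
proof (cases "i = lst_touch x")
  case False
  have f: "fst_touch x < i" "i < lst_touch x"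
    using assms False fst_touch_le[OF assms(1)] lst_touch_ge[OF assms(1)] by auto
  moreover have "lst_touch x \<le> fst_touch x + length x + 1"
    using lst_touch_in[OF assms(1)] fst_touch_in[OF assms(1)] t_le by (simp add: touch_def)
  ultimately show ?thesis
    using three_occ_same_left[of T' x "fst_touch x" i "lst_touch x"] touch_occ
      assms(1) lst_touch_in[OF assms(1)] fst_touch_in[OF assms(1)] by simp
qed simp

lemma occ_before_edit:
  assumes "occ T' x i" "i + length x \<le> length P"
  shows "occ T x i" "lsym T i = lsym T' i"
  using assms by (auto simp: occ_def lsym_def nth_append)

lemma occ_after_edit:
  assumes "occ T' x i" "length P + length t \<le> i"
  shows "occ T x (i - length t + length s)"
proof -
  obtain d where "i = length P + length t + d" using assms(2) le_Suc_ex by blast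
  with assms show ?thesis by (auto simp: occ_def nth_append)
qed

text \<open>Away from the edit, an occurrence and its left neighbour survive in \<open>T\<close>.
  The second bound is strict because the left neighbour must lie in \<open>R\<close> too.\<close>

lemma not_new_left:
  assumes "occ T' x i" "i + length x \<le> length P \<or> length P + length t < i"
  shows "\<not> new_left x i"
proof (cases "i + length x \<le> length P")
  case True
  with occ_before_edit[OF assms(1)] show ?thesis by (auto simp: new_left_def left_ext_def)
next
  case False
  with assms have i: "length P + length t < i" by simp
  then have "lsym T (i - length t + length s) = lsym T' i"
    by (auto simp: lsym_def nth_append less_iff_Suc_add)
  with occ_after_edit[OF assms(1)] i show ?thesis by (auto simp: new_left_def left_ext_def)
qed

lemma not_new_right:
  assumes "occ T' x i" "i + length x < length P \<or> length P + length t \<le> i"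
  shows "\<not> new_right x i"
proof (cases "i + length x < length P")
  case True
  then have "rsym T (i + length x) = rsym T' (i + length x)"
    by (simp add: rsym_def nth_append)
  with occ_before_edit(1)[OF assms(1)] True show ?thesis
    by (auto simp: new_right_def right_ext_def)
next
  case False
  with assms have i: "length P + length t \<le> i" by simp
  then have "rsym T (i - length t + length s + length x) = rsym T' (i + length x)"
    by (auto simp: rsym_def nth_append le_iff_add)
  with occ_after_edit[OF assms(1)] i show ?thesis by (auto simp: new_right_def right_ext_def)
qed

lemma new_left_range:
  "occ T' x i \<Longrightarrow> new_left x i \<Longrightarrow> length P < i + length x \<and> i \<le> length P + length t"
  using not_new_left[of x i] by (meson leI)

lemma new_right_range:
  "occ T' x i \<Longrightarrow> new_right x i \<Longrightarrow> length P \<le> i + length x \<and> i < length P + length t"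
  using not_new_right[of x i] by (meson leI)

lemma new_left_touch: "occ T' x i \<Longrightarrow> new_left x i \<Longrightarrow> i \<in> touch x"
  using new_left_range[of x i] by (simp add: touch_def)

lemma new_right_touch: "occ T' x i \<Longrightarrow> new_right x i \<Longrightarrow> i \<in> touch x"
  using new_right_range[of x i] by (simp add: touch_def)

lemma new_right_le: "occ T' x i \<Longrightarrow> new_right x i \<Longrightarrow> i \<le> length P"
  using new_right_range[of x i] t_le by simp

lemma left_witness:
  assumes "x \<in> LeftM T'" "x \<notin> LeftM T"
  obtains i where "i \<in> touch x" "new_left x i"
proof -
  obtain \<sigma> where "left_ext T' x \<sigma>" "\<not> left_ext T x \<sigma>"
    using assms unfolding LeftM_iff by blast
  then obtain i where "occ T' x i" "new_left x i" by (auto simp: left_ext_def new_left_def)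
  with new_left_touch that show thesis by blast
qed

lemma right_witness:
  assumes "x \<in> RightM T'" "x \<notin> RightM T"
  obtains i where "i \<in> touch x" "new_right x i"
proof -
  obtain \<sigma> where "right_ext T' x \<sigma>" "\<not> right_ext T x \<sigma>"
    using assms unfolding RightM_iff by blast
  then obtain i where "occ T' x i" "new_right x i" by (auto simp: right_ext_def new_right_def)
  with new_right_touch that show thesis by blast
qed

lemma new_letter_touch:
  assumes "a \<in> new_letters x"
  obtains i where "i \<in> touch x" "new_right x i" "rsym T' (i + length x) = Some a"
proof -
  obtain i where "occ T' x i" "rsym T' (i + length x) = Some a"
    using assms unfolding new_letters_def snoc_Substr_iff right_ext_def by blast
  moreover from this have "new_right x i"
    using assms unfolding new_letters_def new_right_def snoc_Substr_iff by simp
  ultimately show thesis using new_right_touch that by blast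
qed

lemma touch_prefix:
  assumes "i \<in> touch x" "i \<le> length P"
  obtains z where "x = drop i P @ z"
proof -
  have l: "length (drop i P) \<le> length x" using assms by (auto simp: touch_def)
  have "take (length (drop i P)) x = drop i P"
  proof (rule nth_equalityI)
    fix k assume "k < length (take (length (drop i P)) x)"
    then show "take (length (drop i P)) x ! k = drop i P ! k"
      using occ_nth[OF touch_occ[OF assms(1)], of k] l assms(2)
      by (simp add: nth_append less_diff_conv add.commute)
  qed (use l in simp)
  then have "x = drop i P @ drop (length (drop i P)) x" by (metis append_take_drop_id)
  then show thesis by (rule that)
qed

lemma occ_drop: "i \<le> length P \<Longrightarrow> occ T (drop i P) i"
  by (auto simp: occ_def nth_append)

lemma lsym_same: "i \<le> length P \<Longrightarrow> lsym T i = lsym T' i"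
  by (auto simp: lsym_def nth_append)

lemma left_ext_drop: "i \<le> length P \<Longrightarrow> left_ext T (drop i P) (lsym T' i)"
  using occ_drop lsym_same by (auto simp: left_ext_def)

text \<open>As a prefix of \<open>x\<close>, \<open>drop i P\<close> inherits a left symbol of
  \<open>x\<close> in \<open>T\<close>; the symbol at \<open>i\<close> is another one, being new for
  \<open>x\<close>.\<close>

lemma new_left_LeftM:
  assumes "x \<in> Substr T" "i \<in> touch x" "new_left x i" "i \<le> length P"
  shows "drop i P \<in> LeftM T"
proof -
  obtain z where z: "x = drop i P @ z" using touch_prefix assms(2,4) by blast
  obtain j where "occ T x j" using assms(1) by (auto simp: Substr_iff_occ)
  then have l: "left_ext T x (lsym T j)" by (auto simp: left_ext_def)
  then have "lsym T j \<noteq> lsym T' i" using assms(3) by (auto simp: new_left_def)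
  moreover have "left_ext T (drop i P) (lsym T j)" using l z left_ext_prefix by metis
  ultimately show ?thesis using left_ext_drop[OF assms(4)] unfolding LeftM_iff by blast
qed

text \<open>The prefix \<open>drop i P\<close> of \<open>x\<close> also starts at \<open>j\<close>,
  where it ends inside \<open>P\<close> and so is unaffected by the edit.\<close>

lemma touches_occ_drop:
  assumes "i \<in> touch x" "j \<in> touch x" "j < i" "i \<le> length P"
  shows "occ T (drop i P) j" "left_ext T (drop i P) (lsym T' j)"
proof -
  obtain z where z: "x = drop i P @ z" using touch_prefix assms(1,4) by blast
  have "occ T' (drop i P) j" using touch_occ[OF assms(2)] z occ_prefix by metis
  moreover have "j + length (drop i P) \<le> length P" using assms by simp
  ultimately have "occ T (drop i P) j" "lsym T j = lsym T' j" using occ_before_edit by blast+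
  then show "occ T (drop i P) j" "left_ext T (drop i P) (lsym T' j)"
    by (auto simp: left_ext_def)
qed

lemma distinct_left_LeftM:
  assumes "i \<in> touch x" "j \<in> touch x" "j < i" "i \<le> length P" "lsym T' j \<noteq> lsym T' i"
  shows "drop i P \<in> LeftM T"
  using touches_occ_drop(2)[OF assms(1-4)] left_ext_drop[OF assms(4)] assms(5)
  unfolding LeftM_iff by blast

section \<open>Covered and uncovered strings\<close>

lemma covered_bound:
  assumes "covered x" "x \<in> RightM T'"
  shows "card (new_letters x) + (if x \<in> RightM T then 0 else 1) \<le> 2 * card (good x)"
proof -
  have "Some ` new_letters x \<subseteq> (\<lambda>j. rsym T' (j + length x)) ` good x"
  proof (rule image_subsetI)
    fix a assume "a \<in> new_letters x"
    then obtain i where "i \<in> touch x" "new_right x i" "rsym T' (i + length x) = Some a"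
      by (rule new_letter_touch)
    with assms(1) show "Some a \<in> (\<lambda>j. rsym T' (j + length x)) ` good x"
      unfolding covered_def by force
  qed
  then have "card (Some ` new_letters x) \<le> card (good x)"
    by (meson card_image_le card_mono finite_good finite_imageI le_trans)
  then have "card (new_letters x) \<le> card (good x)" by (simp add: card_image)
  \<comment> \<open>A string that becomes right-maximal has a new right symbol, hence a good
    position, so the factor 2 absorbs the extra edge.\<close>
  moreover have "1 \<le> card (good x)" if nR: "x \<notin> RightM T"
  proof -
    obtain i where "i \<in> touch x" "new_right x i" using right_witness[OF assms(2) nR] .
    then have "good x \<noteq> {}" using assms(1) unfolding covered_def by blast
    then show ?thesis using finite_good by (simp add: Suc_le_eq card_gt_0_iff)
  qed
  ultimately show ?thesis by auto
qed

text \<open>At touching occurrences the uncovered right symbol comes only with old left symbols, yet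
  \<open>x\<close> needs a new left symbol somewhere. Periodicity places the former at the first
  touching occurrence and the latter at the last, with none between.\<close>

lemma uncovered_shape:
  assumes M: "x \<in> MaxRep T'" and sub: "x \<in> Substr T" and unc: "\<not> covered x"
  defines "f \<equiv> fst_touch x" and "l \<equiv> lst_touch x"
  shows "touch x = {f, l}" "f < l" "lsym T' f \<noteq> lsym T' l"
    "rsym T' (f + length x) \<noteq> rsym T' (l + length x)" "new_right x f" "new_left x l"
proof -
  from unc obtain i where i: "i \<in> touch x" "new_right x i"
    and nc: "\<And>j. j \<in> good x \<Longrightarrow> rsym T' (j + length x) \<noteq> rsym T' (i + length x)"
    unfolding covered_def by blast
  have notL: "drop j P \<notin> LeftM T" "\<not> new_left x j"
    if j: "j \<in> touch x" "rsym T' (j + length x) = rsym T' (i + length x)" for j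
  proof -
    have "new_right x j" using i j by (simp add: new_right_def)
    moreover from this have le: "j \<le> length P" using new_right_le touch_occ j by blast
    ultimately show "drop j P \<notin> LeftM T" using nc[of j] j unfolding good_def by blast
    then show "\<not> new_left x j" using new_left_LeftM[OF sub j(1)] le by blast
  qed
  have ile: "i \<le> length P" using new_right_le touch_occ i by blast
  have "x \<notin> LeftM T"
  proof
    assume "x \<in> LeftM T"
    moreover obtain z where "x = drop i P @ z" using touch_prefix[OF i(1) ile] .
    ultimately have "drop i P \<in> LeftM T" using LeftM_prefix by metis
    with notL(1)[OF i(1)] show False by simp
  qed
  then obtain w where w: "w \<in> touch x" "new_left x w"
    using left_witness[of x] M unfolding MaxRep_def by blast
  have f: "f \<in> touch x" and l: "l \<in> touch x"
    using fst_touch_in[OF i(1)] lst_touch_in[OF i(1)] by (simp_all add: f_def l_def)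
  have wi: "lsym T' w \<noteq> lsym T' i"
    using w(2) notL(2)[OF i(1)] by (auto simp: new_left_def)
  \<comment> \<open>Otherwise \<open>i\<close> and \<open>l\<close> share their left symbol, and a
    different one at \<open>f\<close> would make \<open>drop i P\<close> left-maximal; so all left
    symbols would agree, against \<open>wi\<close>.\<close>
  have "i = f"
  proof (rule ccontr)
    assume n: "i \<noteq> f"
    then have li: "lsym T' i = lsym T' l" using touch_lsym[OF i(1)] by (simp add: f_def l_def)
    have "f < i" using n fst_touch_le[OF i(1)] by (simp add: f_def)
    then have "lsym T' f = lsym T' i"
      using distinct_left_LeftM[OF i(1) f _ ile] notL(1)[OF i(1)] by blast
    then have "lsym T' w = lsym T' i"
      using li touch_lsym[OF w(1)] by (cases "w = f") (auto simp: f_def l_def)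
    with wi show False by blast
  qed
  have "w \<noteq> f" using wi \<open>i = f\<close> by auto
  then have wl: "lsym T' w = lsym T' l" using touch_lsym[OF w(1)] by (simp add: f_def l_def)
  then show nl: "new_left x l" using w(2) by (simp add: new_left_def)
  show ls: "lsym T' f \<noteq> lsym T' l" using wl wi \<open>i = f\<close> by auto
  then show "f < l" using fst_touch_le[OF l] by (cases "f = l") (auto simp: f_def)
  show "new_right x f" using i \<open>i = f\<close> by simp
  show "rsym T' (f + length x) \<noteq> rsym T' (l + length x)"
    using notL(2)[OF l] nl \<open>i = f\<close> by auto
  have "j = f \<or> j = l" if j: "j \<in> touch x" for j
  proof (rule ccontr)
    assume n: "\<not> (j = f \<or> j = l)"
    then have "rsym T' (j + length x) = rsym T' (i + length x)"
      using touch_rsym[OF j] \<open>i = f\<close> by (simp add: f_def l_def)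
    then have "\<not> new_left x j" using notL(2)[OF j] by blast
    moreover have "lsym T' j = lsym T' l" using touch_lsym[OF j] n by (simp add: f_def l_def)
    ultimately show False using nl by (simp add: new_left_def)
  qed
  with f l show "touch x = {f, l}" by blast
qed

text \<open>Among occurrences with a new right symbol only the first can fail to be good: at the
  last, the two different left symbols make \<open>drop i P\<close> left-maximal.\<close>

lemma uncovered_bound:
  assumes "x \<in> MaxRep T'" "x \<in> Substr T" "\<not> covered x"
  shows "card (new_letters x) \<le> card (good x) + 1"
proof -
  note sh = uncovered_shape[OF assms]
  let ?r = "\<lambda>j. rsym T' (j + length x)"
  have "Some ` new_letters x \<subseteq> ?r ` insert (fst_touch x) (good x)"
  proof (rule image_subsetI)
    fix a assume "a \<in> new_letters x"
    then obtain i where i: "i \<in> touch x" "new_right x i" "?r i = Some a"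
      by (rule new_letter_touch)
    have "i = fst_touch x \<or> i \<in> good x"
    proof (cases "i = fst_touch x")
      case False
      then have il: "i = lst_touch x" using sh(1) i(1) by auto
      have "i \<le> length P" using i new_right_le touch_occ by blast
      moreover from this have "drop i P \<in> LeftM T"
        using distinct_left_LeftM[of i x "fst_touch x"] sh(1-3) il by auto
      ultimately show ?thesis using i by (simp add: good_def)
    qed simp
    then show "Some a \<in> ?r ` insert (fst_touch x) (good x)" using i(3) by force
  qed
  then have "card (Some ` new_letters x) \<le> card (insert (fst_touch x) (good x))"
    by (meson card_image_le card_mono finite_good finite_imageI finite_insert le_trans)
  also have "\<dots> \<le> card (good x) + 1" by (simp add: card_insert_if finite_good)
  finally show ?thesis by (simp add: card_image)
qed

lemma card_new_letters: "card (new_letters x) \<le> 2"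
proof -
  let ?r = "\<lambda>j. rsym T' (j + length x)"
  have "Some ` new_letters x \<subseteq> {?r (fst_touch x), ?r (lst_touch x)}"
  proof (rule image_subsetI)
    fix a assume "a \<in> new_letters x"
    then obtain i where i: "i \<in> touch x" "new_right x i" "?r i = Some a"
      by (rule new_letter_touch)
    then show "Some a \<in> {?r (fst_touch x), ?r (lst_touch x)}"
      using touch_rsym[OF i(1)] by (cases "i = lst_touch x") auto
  qed
  then have "card (Some ` new_letters x) \<le> card {?r (fst_touch x), ?r (lst_touch x)}"
    by (intro card_mono) auto
  also have "\<dots> \<le> 2" by (simp add: card_insert_if)
  finally show ?thesis by (simp add: card_image)
qed

text \<open>All occurrences of \<open>x\<close> touch the edit. Equal left symbols at
  \<open>f\<close> and \<open>l\<close> would be equal throughout, so \<open>x\<close> would be a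
  prefix occurring once, and right-maximality would force \<open>x = T'\<close>. Equal right symbols
  would force \<open>f = l\<close>.\<close>

lemma fresh_shape:
  assumes M: "x \<in> MaxRep T'" and ns: "x \<notin> Substr T" and neq: "x \<noteq> T'"
  defines "f \<equiv> fst_touch x" and "l \<equiv> lst_touch x"
  shows "l \<in> touch x" "lsym T' f \<noteq> lsym T' l"
    "rsym T' (f + length x) \<noteq> rsym T' (l + length x)"
proof -
  have tch: "i \<in> touch x" if "occ T' x i" for i
    using new_left_touch[OF that] ns left_ext_Substr by (auto simp: new_left_def)
  obtain i0 where i0: "occ T' x i0"
    using M by (auto simp: MaxRep_def LeftM_def Substr_iff_occ)
  show l: "l \<in> touch x" using lst_touch_in tch i0 by (auto simp: l_def)
  have f: "f \<in> touch x" using fst_touch_in tch i0 by (auto simp: f_def)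
  show ls: "lsym T' f \<noteq> lsym T' l"
  proof
    assume eq: "lsym T' f = lsym T' l"
    have s: "lsym T' i = lsym T' f" if "occ T' x i" for i
      using touch_lsym[OF tch[OF that]] eq by (cases "i = f") (auto simp: f_def l_def)
    then have "lsym T' f = None"
      using M unfolding MaxRep_def Int_iff LeftM_iff left_ext_def by metis
    then have z: "i = 0" if "occ T' x i" for i
      using s[OF that] by (auto simp: lsym_def split: if_splits)
    then have "right_ext T' x None"
      using M unfolding MaxRep_def Int_iff RightM_iff right_ext_def by metis
    then obtain i where i: "occ T' x i" "rsym T' (i + length x) = None"
      by (auto simp: right_ext_def)
    then have "occ T' x 0" "length x = length T'"
      using z[OF i(1)] occ_le[OF i(1)] by (auto simp: rsym_def split: if_splits)
    moreover have "occ T' T' 0" by (simp add: occ_def)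
    ultimately show False using occ_unique neq by blast
  qed
  show "rsym T' (f + length x) \<noteq> rsym T' (l + length x)"
  proof
    assume eq: "rsym T' (f + length x) = rsym T' (l + length x)"
    have s: "rsym T' (i + length x) = rsym T' (f + length x)" if "occ T' x i" for i
      using touch_rsym[OF tch[OF that]] eq by (cases "i = l") (auto simp: f_def l_def)
    then have "rsym T' (f + length x) = None"
      using M unfolding MaxRep_def Int_iff RightM_iff right_ext_def by metis
    then have "f + length x \<ge> length T'" "l + length x \<ge> length T'"
      using eq by (auto simp: rsym_def split: if_splits)
    then have "f = l" using occ_le[OF touch_occ[OF f]] occ_le[OF touch_occ[OF l]] by linarith
    with ls show False by simp
  qed
qed

section \<open>Exceptional strings and their charges\<close>

definition exceptional :: "'a list set" where
  "exceptional = {x \<in> MaxRep T'. if x \<in> Substr T then \<not> covered x else x \<noteq> T'}"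

definition dominated :: "'a list set" where
  "dominated = {x \<in> exceptional. \<exists>y\<in>exceptional. lst_touch y = lst_touch x \<and> length x < length y}"

lemma finite_exceptional: "finite exceptional"
  by (rule finite_subset[OF _ finite_MaxRep[of T']]) (auto simp: exceptional_def)

lemma exceptional_shape:
  assumes "x \<in> exceptional"
  shows "lst_touch x \<in> touch x" "fst_touch x \<in> touch x" "fst_touch x < lst_touch x"
    "lsym T' (fst_touch x) \<noteq> lsym T' (lst_touch x)"
    "rsym T' (fst_touch x + length x) \<noteq> rsym T' (lst_touch x + length x)"
proof -
  have *: "lst_touch x \<in> touch x \<and> lsym T' (fst_touch x) \<noteq> lsym T' (lst_touch x) \<and>
    rsym T' (fst_touch x + length x) \<noteq> rsym T' (lst_touch x + length x)"
    using assms fresh_shape[of x] uncovered_shape[of x] unfolding exceptional_def by (auto split: if_splits)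
  then show l: "lst_touch x \<in> touch x" and ls: "lsym T' (fst_touch x) \<noteq> lsym T' (lst_touch x)"
    and "rsym T' (fst_touch x + length x) \<noteq> rsym T' (lst_touch x + length x)" by auto
  show "fst_touch x \<in> touch x" using fst_touch_in[OF l] .
  have "fst_touch x \<noteq> lst_touch x" using ls by auto
  then show "fst_touch x < lst_touch x" using fst_touch_le[OF l] by simp
qed

text \<open>\<open>x\<close> is a prefix of \<open>y\<close>. If its copy at
  \<open>fst_touch y\<close> were touching, the left symbol there would make it the first touching
  occurrence of \<open>x\<close>, while \<open>y\<close> fixes the same right symbol there as at the
  last one.\<close>

lemma dominated_witness:
  assumes "x \<in> exceptional" "y \<in> exceptional" "lst_touch y = lst_touch x" "length x < length y"
  shows "occ T' x (fst_touch y)" "fst_touch y + length x < length P"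
proof -
  note shx = exceptional_shape[OF assms(1)] and shy = exceptional_shape[OF assms(2)]
  let ?l = "lst_touch x"
  have ox: "occ T' x ?l" and oy: "occ T' y ?l" and oy': "occ T' y (fst_touch y)"
    using shx shy assms(3) touch_occ by auto
  show o: "occ T' x (fst_touch y)"
    using occ_shift[OF ox oy _ _ oy'] assms(4) by simp
  show "fst_touch y + length x < length P"
  proof (rule ccontr)
    assume "\<not> ?thesis"
    then have t: "fst_touch y \<in> touch x"
      using o shy(2) by (simp add: touch_def)
    then have "fst_touch y = fst_touch x"
      using touch_lsym[OF t] shy(4) assms(3) by auto
    moreover have "rsym T' (fst_touch y + length x) = rsym T' (?l + length x)"
      using occ_shift_rsym[OF ox oy _ _ oy'] assms(4) by simp
    ultimately show False using shx(5) by simp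
  qed
qed

lemma dominated_Substr: "x \<in> dominated \<Longrightarrow> x \<in> exceptional \<and> x \<in> Substr T"
proof -
  assume "x \<in> dominated"
  then obtain y where y: "x \<in> exceptional" "y \<in> exceptional" "lst_touch y = lst_touch x" "length x < length y"
    by (auto simp: dominated_def)
  from dominated_witness[OF this] have "occ T x (fst_touch y)" using occ_before_edit by auto
  with y show ?thesis by (auto simp: Substr_iff_occ)
qed

lemma inj_lst_touch: "inj_on lst_touch (exceptional - dominated)"
proof (rule inj_onI)
  fix x y assume xy: "x \<in> exceptional - dominated" "y \<in> exceptional - dominated" "lst_touch x = lst_touch y"
  then have "length x = length y"
    unfolding dominated_def by (auto simp: not_less intro: antisym)
  moreover have "occ T' x (lst_touch x)" "occ T' y (lst_touch x)"
    using xy exceptional_shape(1)[of x] exceptional_shape(1)[of y] touch_occ by auto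
  ultimately show "x = y" using occ_unique by blast
qed

lemma drop_split: "i \<le> j \<Longrightarrow> drop i P = take (j - i) (drop i P) @ drop j P"
  by (metis append_take_drop_id drop_drop le_add_diff_inverse2)

lemma drop_Substr: "i \<le> length P \<Longrightarrow> drop i P \<in> Substr T"
  using occ_drop by (auto simp: Substr_iff_occ)

lemma same_closure_drop:
  assumes "i \<le> j" "j \<le> length P" "closure T (drop i P) = closure T (drop j P)"
    "occ T (drop j P) k"
  shows "j - i \<le> k \<and> occ T (drop i P) (k - (j - i))"
  using same_closure_suffix[OF drop_split[OF assms(1)] drop_Substr, of k] assms by simp

text \<open>For \<open>i < j\<close>, equal closures put \<open>drop i P\<close> around every
  occurrence of \<open>drop j P\<close>, which would then have one fixed left letter.\<close>

lemma inj_closure_drop: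
  "inj_on (\<lambda>i. closure T (drop i P)) {i. i \<le> length P \<and> drop i P \<in> LeftM T}"
proof (rule linorder_inj_onI')
  fix i j assume ij: "i \<in> {i. i \<le> length P \<and> drop i P \<in> LeftM T}"
    "j \<in> {i. i \<le> length P \<and> drop i P \<in> LeftM T}" "i < j"
  show "closure T (drop i P) \<noteq> closure T (drop j P)"
  proof
    assume eq: "closure T (drop i P) = closure T (drop j P)"
    have "lsym T k = lsym T j" if "occ T (drop j P) k" for k
    proof -
      have "j - i \<le> k" "occ T (drop i P) (k - (j - i))"
        using same_closure_drop[OF _ _ eq that] ij by auto
      then show ?thesis
        using occ_shift_lsym[OF occ_drop[of j] occ_drop[of i], of T "k - (j - i)"] ij by simp
    qed
    moreover have "lsym T j \<noteq> None" using ij by (simp add: lsym_def)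
    ultimately show False using ij unfolding mem_Collect_eq LeftM_iff left_ext_def by metis
  qed
qed

lemma card_LeftM_suffixes:
  "card {i. i \<le> length P \<and> drop i P \<in> LeftM T} \<le> card (MaxRep T)"
  by (rule card_inj_on_le[OF inj_closure_drop _ finite_MaxRep])
    (auto intro: closure_MaxRep drop_Substr)

lemma card_lst_touch: "card (lst_touch ` exceptional) \<le> card (MaxRep T)"
proof -
  \<comment> \<open>A last touching occurrence may start just after an inserted letter, at
    \<open>length P + 1\<close>. This single position takes the node \<open>T\<close>, which the
    others avoid because their suffixes occur twice.\<close>
  define \<xi> where "\<xi> l = (if l \<le> length P then closure T (drop l P) else T)" for l
  have L: "drop l P \<in> LeftM T" "closure T (drop l P) \<noteq> T"
    if l: "l \<in> lst_touch ` exceptional" "l \<le> length P" for l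
  proof -
    from l obtain x where x: "x \<in> exceptional" "l = lst_touch x" by blast
    note sh = exceptional_shape[OF x(1)]
    show "drop l P \<in> LeftM T"
      using distinct_left_LeftM[of l x "fst_touch x"] sh l(2) x(2) by auto
    show "closure T (drop l P) \<noteq> T"
      using closure_neq_self[OF occ_drop[OF l(2)] touches_occ_drop(1)[of l x "fst_touch x"]]
        sh l(2) x(2) by auto
  qed
  have B: "l \<le> length P + 1" if "l \<in> lst_touch ` exceptional" for l
    using that exceptional_shape(1) t_le by (fastforce simp: touch_def)
  have "inj_on \<xi> (lst_touch ` exceptional)"
  proof (rule inj_onI)
    fix l k assume a: "l \<in> lst_touch ` exceptional" "k \<in> lst_touch ` exceptional" "\<xi> l = \<xi> k"
    show "l = k"
    proof (cases "l \<le> length P"; cases "k \<le> length P")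
      assume "l \<le> length P" "k \<le> length P"
      then show ?thesis using a L inj_onD[OF inj_closure_drop, of l k] by (simp add: \<xi>_def)
    next
      assume "\<not> l \<le> length P" "\<not> k \<le> length P"
      then show ?thesis using B[OF a(1)] B[OF a(2)] by simp
    next
      assume "l \<le> length P" "\<not> k \<le> length P"
      then show ?thesis using L(2)[OF a(1)] a(3) by (simp add: \<xi>_def)
    next
      assume "\<not> l \<le> length P" "k \<le> length P"
      then show ?thesis using L(2)[OF a(2)] a(3) by (simp add: \<xi>_def)
    qed
  qed
  moreover have "\<xi> ` lst_touch ` exceptional \<subseteq> MaxRep T"
    using self_MaxRep[of T] by (auto simp: \<xi>_def intro: closure_MaxRep drop_Substr)
  ultimately show ?thesis using card_inj_on_le finite_MaxRep by blast
qed

text \<open>Let \<open>y\<close> be a longer exceptional string with the same last touching occurrence as \<open>x\<close>. Then \<open>x\<close>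
  is a suffix of \<open>X\<close> ending at the same place at the first touching occurrences, and the repetition
  spanned by \<open>y\<close> starts before the one spanned by \<open>X\<close>. If it also ends later, it contains a further
  touching occurrence of \<open>X\<close>; otherwise the two repetitions overlap long enough to share a period,
  and the one of \<open>X\<close> could be extended to the left.\<close>
lemma dominated_closure_contradiction:
  assumes x: "x \<in> dominated" and X: "X \<in> dominated"
    and less: "fst_touch X < fst_touch x"
    and eq: "closure T (drop (fst_touch X) P) = closure T (drop (fst_touch x) P)"
  shows False
proof -
  define f l F L where "f = fst_touch x" and "l = lst_touch x"
    and "F = fst_touch X" and "L = lst_touch X"
  define d where "d = f - F"
  obtain y where y: "y \<in> exceptional" "lst_touch y = l" "length x < length y"
    using x by (auto simp: dominated_def l_def)
  define fy where "fy = fst_touch y"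
  have xX: "x \<in> exceptional" "X \<in> exceptional" and S: "x \<in> Substr T" "X \<in> Substr T" using x X dominated_Substr by auto
  then have M: "x \<in> MaxRep T'" "X \<in> MaxRep T'" "\<not> covered x" "\<not> covered X"
    by (auto simp: exceptional_def)
  note shx = uncovered_shape[OF M(1) S(1) M(3), folded f_def l_def]
    and shX = uncovered_shape[OF M(2) S(2) M(4), folded F_def L_def]
    and shy = exceptional_shape[OF y(1), folded fy_def, unfolded y(2)]
  have t: "f \<in> touch x" "l \<in> touch x" "F \<in> touch X" "L \<in> touch X" using shx shX by auto
  note o = t[THEN touch_occ]
  have oy: "occ T' y fy" "occ T' y l" using shy touch_occ by auto
  have yP: "length P \<le> fy + length y" using shy(2) by (simp add: touch_def)
  have fP: "f \<le> length P" using new_right_le[OF o(1) shx(5)] .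
  have Ff: "F < f" using less by (simp add: f_def F_def)
  have lP: "l \<le> length P + length t" "L \<le> length P + length t" using t by (auto simp: touch_def)
  have G: "d \<le> j \<and> occ T (drop F P) (j - d)" if "occ T (drop f P) j" for j
    using same_closure_drop[OF _ fP _ that, of F] eq Ff by (simp add: d_def f_def F_def)
  \<comment> \<open>Such an occurrence lies inside \<open>drop F P\<close>, which by
    \<open>G\<close> accompanies every occurrence of \<open>drop f P\<close>; each of these would
    yield another one further left.\<close>
  have H: "\<not> (F \<le> j \<and> j < f)" if j: "occ T (drop f P) j" for j
  proof
    assume Fj: "F \<le> j \<and> j < f"
    have "\<exists>k'<k. occ T (drop f P) k'" if k: "occ T (drop f P) k" for k
    proof -
      have "occ T (drop f P) (k - d + (j - F))"
        by (rule occ_shift[OF j occ_drop[of F]]) (use G[OF k] Fj Ff fP in auto)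
      then show ?thesis using G[OF k] Fj Ff by (intro exI[of _ "k - d + (j - F)"]) (auto simp: d_def)
    qed
    then show False using no_descent[OF j] by blast
  qed
  obtain z where z: "x = drop f P @ z" using touch_prefix[OF t(1) fP] .
  have w: "occ T' x fy" "fy + length x < length P"
    using dominated_witness[OF xX(1) y(1)] y by (auto simp: fy_def l_def)
  have "fy < F"
  proof -
    have "occ T x fy" using occ_before_edit(1)[OF w(1)] w(2) by simp
    then have "occ T (drop f P) fy" using z occ_prefix by metis
    moreover have "fy < f" using w(2) t(1) by (simp add: touch_def)
    ultimately show ?thesis using H by force
  qed
  \<comment> \<open>Were \<open>X\<close> to end later, it would contain \<open>x\<close> with its
    new right symbol. Were \<open>x\<close> to end later, an occurrence of \<open>x\<close> in
    \<open>T\<close>, enlarged to the left by \<open>G\<close>, would contain \<open>X\<close> with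
    its new right symbol.\<close>
  have same_end: "F + length X = f + length x"
  proof (rule antisym)
    show "F + length X \<le> f + length x"
      using inner_right_ext[OF o(1) o(3) _ _ S(2)] shx(5) Ff
      by (force simp: new_right_def)
    show "f + length x \<le> F + length X"
    proof (rule ccontr)
      assume n: "\<not> f + length x \<le> F + length X"
      obtain j where j: "occ T x j" using S(1) by (auto simp: Substr_iff_occ)
      then have "occ T (drop f P) j" using z occ_prefix by metis
      with G have dj: "d \<le> j" and pF: "occ T (drop F P) (j - d)" by auto
      have eqn: "T ! (j - d + k) = T' ! (F + k)" if k: "F + k < f + length x" for k
      proof (cases "k < length (drop F P)")
        case True
        then have "F + k < length P" by simp
        with occ_nth[OF pF True] show ?thesis by (simp add: nth_append)
      next
        case False
        then have dk: "d \<le> k" using Ff fP by (simp add: d_def)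
        have kx: "k - d < length x" using k dk Ff by (simp add: d_def)
        have "j - d + k = j + (k - d)" "F + k = f + (k - d)" using dk dj Ff by (auto simp: d_def)
        with occ_nth[OF j kx] occ_nth[OF o(1) kx] show ?thesis by simp
      qed
      have len: "j - d + length X < length T"
        using n dj occ_le[OF j] Ff by (simp add: d_def)
      have "occ T X (j - d)"
        unfolding occ_def using len n eqn occ_nth[OF o(3)] by auto
      moreover have "rsym T (j - d + length X) = rsym T' (F + length X)"
        using len n eqn[of "length X"] occ_le[OF o(1)] by (simp add: rsym_def)
      ultimately have "\<not> new_right X F" by (auto simp: new_right_def right_ext_def)
      with shX(5) show False by blast
    qed
  qed
  \<comment> \<open>\<open>x\<close> is the tail of \<open>X\<close>, so it also ends the copy of
    \<open>X\<close> at \<open>L\<close>, with the left symbol found at \<open>f\<close>. Neither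
    \<open>f\<close> nor \<open>l\<close> can be its start, so it starts beyond the edit.\<close>
  have oLd: "occ T' x (L + d)"
    using occ_shift[OF o(1) o(3) _ _ o(4)] same_end Ff by (simp add: d_def)
  have sLd: "lsym T' (L + d) = lsym T' f"
    using occ_shift_lsym[OF o(1) o(3) _ _ o(4)] same_end Ff by (simp add: d_def)
  have "L + d \<notin> touch x"
    using sLd shx(1,3) shX(2) Ff by (auto simp: d_def)
  then have Ld: "length P + length t < L + d"
    using oLd t(4) same_end Ff by (auto simp: touch_def d_def)
  have "\<not> L < l"
  proof
    assume "L < l"
    moreover have "l + length x \<le> L + length X" using lP(1) Ld same_end Ff by (simp add: d_def)
    ultimately have "left_ext T x (lsym T' l)" by (rule inner_left_ext[OF o(2) o(4) _ _ S(2)])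
    with shx(6) show False by (simp add: new_left_def)
  qed
  moreover have "l \<noteq> L"
  proof
    assume lL: "l = L"
    have "occ T' x F"
      using occ_shift[OF o(2) o(4) _ _ o(3)] lL same_end Ff by simp
    then have "occ T' (drop f P) F" using z occ_prefix by metis
    then have "occ T (drop f P) F" using occ_before_edit(1) Ff fP by simp
    with H Ff show False by blast
  qed
  ultimately have lL: "l < L" by simp
  show False
  proof (cases "L + length X \<le> l + length y")
    case True
    \<comment> \<open>The copy of \<open>X\<close> at \<open>L\<close> moves with \<open>y\<close>
      from \<open>l\<close> to \<open>fy\<close>. Its left symbol is new, so it must touch the edit,
      but it can start neither at \<open>F\<close> nor at \<open>L\<close>.\<close>
    have o': "occ T' X (fy + (L - l))"
      using occ_shift[OF o(4) oy(2) _ True oy(1)] lL by simp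
    have s': "lsym T' (fy + (L - l)) = lsym T' L"
      using occ_shift_lsym[OF o(4) oy(2) lL True oy(1)] .
    then have "new_left X (fy + (L - l))" using shX(6) by (simp add: new_left_def)
    then have "fy + (L - l) \<in> {F, L}" using new_left_touch[OF o'] shX(1) by simp
    moreover have "fy + (L - l) \<noteq> L" using shy(3) lL by simp
    ultimately show False using s' shX(3) by auto
  next
    case False
    \<comment> \<open>\<open>a\<close> is the period of the stretch spanned by the two copies of
      \<open>y\<close>, \<open>b\<close> that of the stretch spanned by the two copies of
      \<open>X\<close>.\<close>
    define a b where "a = l - fy" and "b = L - F"
    have ab: "0 < a" "0 < b" using shy(3) shX(2) by (auto simp: a_def b_def)
    have py: "T' ! (k + a) = T' ! k" if "fy \<le> k" "k < fy + length y" for k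
    proof -
      have "k - fy < length y" using that by simp
      from occ_nth[OF oy(1) this] occ_nth[OF oy(2) this] show ?thesis
        using that shy(3) by (simp add: a_def add.commute)
    qed
    have p1: "T' ! (F + (a - 1)) = T' ! (F + (b - 1))"
    proof (rule two_periods[of a b "\<lambda>n. T' ! (F + n)", OF ab])
      fix k assume k: "k < b - 1"
      then have "F + k < length P" using lP(2) t_le by (simp add: b_def)
      then show "T' ! (F + (k + a)) = T' ! (F + k)"
        using py[of "F + k"] \<open>fy < F\<close> yP by (simp add: add.assoc)
    next
      fix k assume k: "k < a - 1"
      have kX: "k < length X" using k False yP lP(2) t_le shy(3) by (simp add: a_def)
      show "T' ! (F + (k + b)) = T' ! (F + k)"
        using occ_nth[OF o(3) kX] occ_nth[OF o(4) kX] shX(2)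
        by (simp add: b_def add.commute add.left_commute)
    qed
    \<comment> \<open>Since \<open>fy < F\<close>, the period \<open>a\<close> also reaches the
      letter before \<open>F\<close>, which thus equals the one before \<open>L\<close>.\<close>
    have p2: "T' ! (F - 1 + a) = T' ! (F - 1)"
      using py[of "F - 1"] \<open>fy < F\<close> yP Ff fP by simp
    have e1: "F - 1 + a = F + (a - 1)" using ab(1) \<open>fy < F\<close> by linarith
    have e2: "F + (b - 1) = L - 1" using shX(2) by (simp add: b_def)
    have "T' ! (F - 1) = T' ! (L - 1)" using p1 p2 unfolding e1 e2 by (rule trans[OF sym, rotated])
    then have "lsym T' F = lsym T' L"
      using \<open>fy < F\<close> shX(2) by (simp add: lsym_def)
    with shX(3) show False by blast
  qed
qed

text \<open>Strings with the same first touching occurrence coincide, as the longer would contain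
  the shorter with its new right symbol. The node \<open>T\<close> stays free because each suffix
  used occurs twice.\<close>

lemma card_dominated: "card dominated \<le> card (MaxRep T - {T})"
proof (rule card_inj_on_le[of "\<lambda>x. closure T (drop (fst_touch x) P)"])
  have nr: "new_right x (fst_touch x)" "occ T' x (fst_touch x)" if "x \<in> dominated" for x
  proof -
    have "x \<in> exceptional" "x \<in> Substr T" using dominated_Substr[OF that] by auto
    then show "new_right x (fst_touch x)" "occ T' x (fst_touch x)"
      using uncovered_shape(5)[of x] exceptional_shape(2) touch_occ by (auto simp: exceptional_def)
  qed
  show "inj_on (\<lambda>x. closure T (drop (fst_touch x) P)) dominated"
  proof (rule inj_onI)
    fix x y assume a: "x \<in> dominated" "y \<in> dominated"
      "closure T (drop (fst_touch x) P) = closure T (drop (fst_touch y) P)"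
    have e: "fst_touch x = fst_touch y"
      using dominated_closure_contradiction[OF a(1,2)] dominated_closure_contradiction[OF a(2,1)] a(3)
      by (metis linorder_neqE_nat)
    have "\<not> length x < length y" "\<not> length y < length x"
      using inner_right_ext[OF nr(2)[OF a(1)] nr(2)[OF a(2)]]
        inner_right_ext[OF nr(2)[OF a(2)] nr(2)[OF a(1)]]
        nr(1)[OF a(1)] nr(1)[OF a(2)] dominated_Substr[OF a(1)] dominated_Substr[OF a(2)] e
      by (auto simp: new_right_def)
    then show "x = y" using nr(2) a(1,2) e occ_unique by (metis linorder_neqE_nat)
  qed
  show "(\<lambda>x. closure T (drop (fst_touch x) P)) ` dominated \<subseteq> MaxRep T - {T}"
  proof (rule image_subsetI)
    fix x assume x: "x \<in> dominated"
    then obtain y where y: "x \<in> exceptional" "y \<in> exceptional" "lst_touch y = lst_touch x" "length x < length y"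
      by (auto simp: dominated_def)
    note w = dominated_witness[OF y]
    have fP: "fst_touch x \<le> length P" using new_right_le nr x by blast
    have tf: "fst_touch x \<in> touch x" using exceptional_shape(2) y(1) by blast
    then obtain z where z: "x = drop (fst_touch x) P @ z" using touch_prefix fP by blast
    have "occ T x (fst_touch y)" using occ_before_edit(1)[OF w(1)] w(2) by simp
    then have "occ T (drop (fst_touch x) P) (fst_touch y)" using z occ_prefix by metis
    moreover have "fst_touch y < fst_touch x" using w(2) tf by (simp add: touch_def)
    ultimately have "closure T (drop (fst_touch x) P) \<noteq> T"
      using closure_neq_self[OF occ_drop[OF fP]] by fastforce
    then show "closure T (drop (fst_touch x) P) \<in> MaxRep T - {T}"
      using closure_MaxRep[OF drop_Substr[OF fP]] by simp
  qed
qed (simp add: finite_MaxRep)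

lemma card_exceptional: "card exceptional + 1 \<le> 2 * card (MaxRep T)"
proof -
  have "card (exceptional - dominated) = card (lst_touch ` (exceptional - dominated))" using inj_lst_touch by (simp add: card_image)
  also have "\<dots> \<le> card (lst_touch ` exceptional)" using finite_exceptional by (intro card_mono) auto
  also have "\<dots> \<le> card (MaxRep T)" by (rule card_lst_touch)
  finally have "card (exceptional - dominated) \<le> card (MaxRep T)" .
  moreover have "card (MaxRep T) = card (MaxRep T - {T}) + 1"
    using card.remove[OF finite_MaxRep self_MaxRep, of T] by simp
  moreover have "card exceptional = card (exceptional - dominated) + card dominated"
    using finite_exceptional by (simp add: dominated_def card_Diff_subset card_mono)
  ultimately show ?thesis using card_dominated by linarith
qed

section \<open>Edges of right-maximal words of the original string\<close>

lemma inj_closure_take: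
  "inj_on (\<lambda>n. closure T (take n R)) {n. n \<le> length R \<and> take n R \<in> RightM T}"
proof (rule linorder_inj_onI')
  fix n m assume nm: "n \<in> {n. n \<le> length R \<and> take n R \<in> RightM T}"
    "m \<in> {n. n \<le> length R \<and> take n R \<in> RightM T}" "n < m"
  show "closure T (take n R) \<noteq> closure T (take m R)"
  proof
    assume eq: "closure T (take n R) = closure T (take m R)"
    obtain a where a: "closure T (take n R) = a @ take n R"
      and cl: "\<And>i. occ T (take n R) i \<Longrightarrow>
        length a \<le> i \<and> occ T (closure T (take n R)) (i - length a)"
      using closure_RightM[of "take n R" T] nm(1) by auto
    obtain a' where a': "closure T (take m R) = a' @ take m R"
      using closure_RightM[of "take m R" T] nm(2) by auto
    have "length (a @ take n R) = length (a' @ take m R)" using a a' eq by simp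
    then have l: "length a' < length a" using nm by simp
    \<comment> \<open>The longer prefix has the shorter left context, so the shared closure yields
      an occurrence of \<open>take n R\<close> further left.\<close>
    have "\<exists>k<i. occ T (take n R) k" if "occ T (take n R) i" for i
    proof -
      have "occ T (take m R) (i - length a + length a')"
        using occ_suffix[of T a' "take m R" "i - length a"] cl[OF that] eq a' by simp
      moreover have "take m R = take n R @ take (m - n) (drop n R)"
        using nm(3) by (metis le_add_diff_inverse less_imp_le take_add)
      ultimately have "occ T (take n R) (i - length a + length a')" using occ_prefix by metis
      then show ?thesis using cl[OF that] l
        by (intro exI[of _ "i - length a + length a'"]) auto
    qed
    moreover obtain i where "occ T (take n R) i"
      using nm(1) by (auto simp: RightM_def Substr_iff_occ)
    ultimately show False using no_descent by blast
  qed
qed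

lemma touch_suffix:
  assumes "i \<in> touch x" "length P + length t \<le> i + length x"
  obtains z where "x = z @ take (i + length x - length P - length t) R"
    "i + length x - length P - length t \<le> length R"
proof -
  define n where "n = i + length x - length P - length t"
  have o: "occ T' x i" using touch_occ[OF assms(1)] .
  have nR: "n \<le> length R" using occ_le[OF o] by (simp add: n_def)
  have nx: "n \<le> length x" using assms(1) by (auto simp: touch_def n_def)
  have "drop (length x - n) x = take n R"
  proof (rule nth_equalityI)
    fix k assume "k < length (drop (length x - n) x)"
    then have k: "k < n" using nx by simp
    have "x ! (length x - n + k) = T' ! (i + (length x - n + k))"
      using occ_nth[OF o, of "length x - n + k"] k nx by simp
    also have "i + (length x - n + k) = length P + length t + k"
      using nx assms(2) by (simp add: n_def)
    also have "T' ! \<dots> = R ! k" by (simp add: nth_append)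
    finally show "drop (length x - n) x ! k = take n R ! k" using k nx by simp
  qed (use nx nR in simp)
  then have "x = take (length x - n) x @ take n R" by (metis append_take_drop_id)
  then show thesis using that nR unfolding n_def by blast
qed

text \<open>A new left symbol of \<open>x\<close> is seen at an occurrence reaching at least the
  start of \<open>R\<close>. Its part in \<open>R\<close> is a right-maximal suffix of
  \<open>x\<close>, and passing to it and then to its closure loses no outgoing edges.\<close>

lemma sum_new_left_RightM:
  "(\<Sum>x | x \<in> MaxRep T' \<and> x \<notin> LeftM T \<and> x \<in> RightM T. Dout T x) \<le> cdawg_size T"
proof -
  define N where "N = {x. x \<in> MaxRep T' \<and> x \<notin> LeftM T \<and> x \<in> RightM T}"
  have "\<exists>i. i \<in> touch x \<and> new_left x i" if "x \<in> N" for x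
    using left_witness[of x] that unfolding N_def MaxRep_def by blast
  then obtain w where w: "\<And>x. x \<in> N \<Longrightarrow> w x \<in> touch x \<and> new_left x (w x)" by metis
  define n where "n x = w x + length x - length P - length t" for x
  have o: "occ T' x (w x)" if "x \<in> N" for x using w[OF that] touch_occ by blast
  have end_le: "length P + length t \<le> w x + length x" if "x \<in> N" for x
    using new_left_range[OF o[OF that]] w[OF that] t_le by simp
  have q: "n x \<le> length R" "take (n x) R \<in> RightM T" "Dout T x \<le> Dout T (closure T (take (n x) R))"
    if x: "x \<in> N" for x
  proof -
    obtain z where z: "x = z @ take (n x) R" and le: "n x \<le> length R"
      using touch_suffix[of "w x" x, folded n_def] w[OF x] end_le[OF x] by blast
    show "n x \<le> length R" by (rule le)
    have "x \<in> RightM T" using x by (simp add: N_def)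
    then show rm: "take (n x) R \<in> RightM T" using z RightM_suffix by metis
    have "Dout T x \<le> Dout T (take (n x) R)" using Dout_suffix z by metis
    with Dout_closure[OF rm] show "Dout T x \<le> Dout T (closure T (take (n x) R))" by simp
  qed
  have inj: "inj_on (\<lambda>x. closure T (take (n x) R)) N"
  proof (rule inj_onI)
    fix x y assume xy: "x \<in> N" "y \<in> N" "closure T (take (n x) R) = closure T (take (n y) R)"
    then have "n x = n y" using inj_onD[OF inj_closure_take xy(3)] q by simp
    then have e: "w x + length x = w y + length y"
      using end_le[OF xy(1)] end_le[OF xy(2)] by (simp add: n_def)
    have S: "x \<in> Substr T" "y \<in> Substr T" using xy by (auto simp: N_def RightM_def)
    have "\<not> w x < w y" "\<not> w y < w x"
      using inner_left_ext[OF o[OF xy(1)] o[OF xy(2)] _ _ S(2)]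
        inner_left_ext[OF o[OF xy(2)] o[OF xy(1)] _ _ S(1)] w[OF xy(1)] w[OF xy(2)] e
      by (auto simp: new_left_def)
    then have "w x = w y" by simp
    with e o[OF xy(1)] o[OF xy(2)] show "x = y" using occ_unique by auto
  qed
  have "(\<Sum>x\<in>N. Dout T x) \<le> (\<Sum>x\<in>N. Dout T (closure T (take (n x) R)))"
    using q by (intro sum_mono) auto
  also have "\<dots> = (\<Sum>K\<in>(\<lambda>x. closure T (take (n x) R)) ` N. Dout T K)"
    by (simp add: sum.reindex[OF inj])
  also have "\<dots> \<le> cdawg_size T"
    unfolding cdawg_size_def using q
    by (intro sum_mono2 finite_MaxRep) (auto intro!: closure_MaxRep simp: RightM_def)
  finally show ?thesis unfolding N_def .
qed

section \<open>Adding up the edges\<close>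

lemma good_disjoint:
  assumes "x \<in> Substr T" "y \<in> Substr T" "x \<noteq> y"
  shows "good x \<inter> good y = {}"
proof (rule ccontr)
  assume "good x \<inter> good y \<noteq> {}"
  then obtain i where i: "i \<in> touch x" "i \<in> touch y" "new_right x i" "new_right y i"
    by (auto simp: good_def)
  note o = touch_occ[OF i(1)] touch_occ[OF i(2)]
  have "\<not> length x < length y" "\<not> length y < length x"
    using inner_right_ext[OF o(1,2) _ _ assms(2)] inner_right_ext[OF o(2,1) _ _ assms(1)] i(3,4)
    by (auto simp: new_right_def)
  then show False using occ_unique[OF o] assms(3) by simp
qed

lemma sum_good:
  "(\<Sum>x\<in>MaxRep T' \<inter> Substr T. card (good x)) \<le> card (MaxRep T)"
proof -
  have "(\<Sum>x\<in>MaxRep T' \<inter> Substr T. card (good x))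
      = card (\<Union>x\<in>MaxRep T' \<inter> Substr T. good x)"
    using finite_MaxRep finite_good good_disjoint
    by (intro card_UN_disjoint[symmetric]) auto
  also have "\<dots> \<le> card {i. i \<le> length P \<and> drop i P \<in> LeftM T}"
    by (rule card_mono) (auto simp: good_def)
  also have "\<dots> \<le> card (MaxRep T)" by (rule card_LeftM_suffixes)
  finally show ?thesis .
qed

lemma Dout_bound:
  assumes "x \<in> MaxRep T'"
  shows "Dout T' x \<le> (if x \<in> RightM T then Dout T x else 0)
    + (if x \<in> Substr T then 2 * card (good x) else 0) + (if x \<in> exceptional then 2 else 0)"
proof -
  have R: "x \<in> RightM T'" using assms by (simp add: MaxRep_def)
  have fin: "finite (new_letters x)"
    using finite_out[of x T'] by (rule rev_finite_subset) (auto simp: new_letters_def)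
  have "Dout T' x \<le> card ({a. x @ [a] \<in> Substr T} \<union> new_letters x)"
    unfolding Dout_def by (intro card_mono finite_UnI fin finite_out) (auto simp: new_letters_def)
  also have "\<dots> \<le> Dout T x + card (new_letters x)"
    unfolding Dout_def by (rule card_Un_le)
  finally have D: "Dout T' x \<le> Dout T x + card (new_letters x)" .
  show ?thesis
  proof (cases "x \<in> Substr T")
    case True
    have D1: "Dout T x \<le> (if x \<in> RightM T then Dout T x else 0) + (if x \<in> RightM T then 0 else 1)"
      using Dout_le_1 by auto
    show ?thesis
    proof (cases "covered x")
      case cov: True
      show ?thesis using D D1 covered_bound[OF cov R] True by auto
    next
      case False
      then have "x \<in> exceptional" using True assms by (simp add: exceptional_def)
      with D D1 uncovered_bound[OF assms True False] True show ?thesis by auto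
    qed
  next
    case False
    show ?thesis
    proof (cases "x = T'")
      \<comment> \<open>\<open>T'\<close> is the sink, which is why \<open>exceptional\<close> may
        leave it out.\<close>
      case True
      have "\<not> occ T' (T' @ [a]) i" for a i using occ_le[of T' "T' @ [a]" i] by auto
      then have "{a. x @ [a] \<in> Substr T'} = {}" using True by (auto simp: Substr_iff_occ)
      then show ?thesis unfolding Dout_def by simp
    next
      case neq: False
      then have "x \<in> exceptional" using False assms by (simp add: exceptional_def)
      moreover have "{a. x @ [a] \<in> Substr T} = {}"
        using False right_ext_Substr by (auto simp: snoc_Substr_iff)
      then have "Dout T x = 0" unfolding Dout_def by simp
      ultimately show ?thesis using D card_new_letters[of x] by simp
    qed
  qed
qed

theorem cdawg_size_single_edit: "cdawg_size T' \<le> 8 * cdawg_size T + 4"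
proof -
  let ?M = "MaxRep T'" and ?e = "cdawg_size T" and ?m = "card (MaxRep T)"
  have fin: "finite ?M" by (rule finite_MaxRep)
  have "cdawg_size T' \<le> (\<Sum>x\<in>?M. (if x \<in> RightM T then Dout T x else 0)
      + (if x \<in> Substr T then 2 * card (good x) else 0) + (if x \<in> exceptional then 2 else 0))"
    unfolding cdawg_size_def by (intro sum_mono Dout_bound)
  also have "\<dots> = (\<Sum>x\<in>?M \<inter> RightM T. Dout T x)
      + 2 * (\<Sum>x\<in>?M \<inter> Substr T. card (good x)) + 2 * card exceptional"
  proof -
    have "?M \<inter> exceptional = exceptional" by (auto simp: exceptional_def)
    then show ?thesis
      using fin by (simp add: sum.distrib sum.inter_restrict[symmetric] sum_distrib_left)
  qed
  also have "(\<Sum>x\<in>?M \<inter> RightM T. Dout T x) \<le> 2 * ?e"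
  proof -
    \<comment> \<open>Nodes that \<open>T\<close> already had keep their old edges; the others are
      those that gained left-maximality through the edit. Each class costs at most
      \<open>?e\<close>.\<close>
    have "?M \<inter> RightM T = (?M \<inter> MaxRep T) \<union> {x. x \<in> ?M \<and> x \<notin> LeftM T \<and> x \<in> RightM T}"
      by (auto simp: MaxRep_def)
    then have "(\<Sum>x\<in>?M \<inter> RightM T. Dout T x) \<le> (\<Sum>x\<in>?M \<inter> MaxRep T. Dout T x)
        + (\<Sum>x | x \<in> ?M \<and> x \<notin> LeftM T \<and> x \<in> RightM T. Dout T x)"
      using fin by (simp add: sum_Un_nat)
    also have "(\<Sum>x\<in>?M \<inter> MaxRep T. Dout T x) \<le> ?e"
      unfolding cdawg_size_def by (intro sum_mono2 finite_MaxRep) auto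
    finally show ?thesis using sum_new_left_RightM by simp
  qed
  finally have "cdawg_size T' \<le> 2 * ?e
      + 2 * (\<Sum>x\<in>?M \<inter> Substr T. card (good x)) + 2 * card exceptional" by simp
  then show ?thesis using sum_good card_exceptional card_MaxRep_le[of T] by linarith
qed

end

theorem theorem1:
  fixes T T' :: "'a::finite list"
  assumes "ed T T' = 1"
  shows "cdawg_size T' \<le> 8 * cdawg_size T + 4 \<and>
         (cdawg_size T > 0 \<longrightarrow>
            real (cdawg_size T') / real (cdawg_size T)
              \<le> (8 * real (cdawg_size T) + 4) / real (cdawg_size T))"
proof -
  obtain P s t R where e: "T = P @ s @ R" "T' = P @ t @ R" "length t \<le> 1"
    using ed_1_single_edit[OF assms] by blast
  interpret single_edit P s t R by unfold_locales (rule e(3))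
  have "cdawg_size T' \<le> 8 * cdawg_size T + 4" using cdawg_size_single_edit e by simp
  moreover from this have "real (cdawg_size T') \<le> 8 * real (cdawg_size T) + 4" by linarith
  ultimately show ?thesis by (simp add: divide_right_mono)
qed

end
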